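(* If $\|R(t,\xi)\|_2$ and $\|W(t)\|_2$ are bounded for every $t>0$, where $R(t,\xi)$ and $W(t)$ are the time-dependent Fourier kernels and weights of the layers of a CTFNO, then the corresponding CTFNO with a Lipschitz continuous activation function is stable.
   Context: Let $\Omega\subset\mathbb{R}^n$ be a bounded domain. A CTFNO (continuous-time Fourier neural operator) maps a time $t$ and an initial function $u_0:\Omega\to\mathbb{R}^{d_a}$ to $$u(t,\cdot)=\mathcal{Q}\circ\mathcal{L}_L\circ\cdots\circ\mathcal{L}_1\circ\mathcal{P}(u_0),$$ where $\mathcal{P}(u_0)(x)=Pu_0(x)$ with a matrix $P\in\mathbb{R}^{d_v\times d_a}$, $\mathcal{Q}(v)(x)=Qv(x)$ with a matrix $Q\in\mathbb{R}^{d_u\times d_v}$, and each layer at time $t\in[0,\infty)$ is given, for $v:\Omega\to\mathbb{R}^{d_v}$ and $x\in\Omega$, by $$\mathcal{L}_\ell(v)(t,x)=\sigma\Big(W_\ell(t)v(x)+\mathcal{F}^{-1}\big(R_\ell(t,\cdot)\cdot(\mathcal{F}v)\big)(x)\Big).$$ Here $\sigma:\mathbb{R}\to\mathbb{R}$ is the activation function, applied componentwise; $\mathcal{F}$ is the Fourier transform in the spatial variable, with inverse $\mathcal{F}^{-1}$ and frequency variable $\xi$; $W_\ell(t)=W_\ell\psi_\ell(t)$ with $W_\ell$ a linear map on $\mathbb{R}^{d_v}$ and $\psi_\ell(t)$ a real diagonal $d_v\times d_v$ matrix; and $R_\ell(t,\xi)=\varphi_\ell(t,\xi)R_\ell(\xi)$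 with $R_\ell=\mathcal{F}(\kappa_\ell)$ the transform of a $d_v\times d_v$ matrix-valued convolution kernel $\kappa_\ell$ and $\varphi_\ell(t,\xi)\in\mathbb{C}$. In the claim the layer index $\ell$ is suppressed, and $\|\cdot\|_2$ is the matrix 2-norm. Stability: a time-dependent PDE (here, the solution operator $(t,u_0)\mapsto u(t,\cdot)$ given by the CTFNO) is stable if for any solution $u(t,x)$ with initial condition $u_0(x)$ and any $\epsilon>0$, there exists $\delta>0$ such that for every new initial function $\tilde u_0(x)$ satisfying $\|\tilde u_0-u_0\|<\delta$, the corresponding solution $\tilde u(t,x)$ satisfies $\|\tilde u-u\|<\epsilon$ for all $t\ge 0$. Here $\|\cdot\|$ is the $L^2$ norm in the spatial variable. *)

theory Defs
  imports "HOL-Analysis.Analysis"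
begin

section \<open>Square-integrable functions\<close>

(* A function on Omega is represented by a total function of which only the values on Omega
   matter. *)

definition square_integrable :: "(real^'n) set \<Rightarrow> (real^'n \<Rightarrow> 'b::euclidean_space) \<Rightarrow> bool" where
  "square_integrable \<Omega> f \<longleftrightarrow>
     set_borel_measurable lborel \<Omega> f \<and> set_integrable lborel \<Omega> (\<lambda>x. (norm (f x))\<^sup>2)"

definition L2_norm :: "(real^'n) set \<Rightarrow> (real^'n \<Rightarrow> 'b::euclidean_space) \<Rightarrow> real" where
  "L2_norm \<Omega> f = sqrt (LINT x:\<Omega>|lborel. (norm (f x))\<^sup>2)"


section \<open>The Fourier transform on the union of L1 and L2\<close>

definition fourier_integral :: "real \<Rightarrow> (real^'n \<Rightarrow> complex) \<Rightarrow> real^'n \<Rightarrow> complex" where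
  "fourier_integral s f \<xi> = (LINT x|lborel. f x * cis (s * 2 * pi * (x \<bullet> \<xi>)))"

(* On L1 the transform is the integral; on L2 it is the L2 limit of the transforms of the
   truncations of f to balls, hence only determined up to a null set.  The limit is stated with
   the nonnegative integral because the Bochner integral of a non-integrable function is 0. *)
definition fourier_sign :: "real \<Rightarrow> (real^'n \<Rightarrow> complex) \<Rightarrow> real^'n \<Rightarrow> complex" where
  "fourier_sign s f =
     (if integrable lborel f then fourier_integral s f
      else (SOME g. square_integrable UNIV g \<and>
              (\<lambda>r::nat. \<integral>\<^sup>+ \<xi>. ennreal ((cmod (fourier_integral s
                    (\<lambda>x. indicator (cball 0 (real r)) x *\<^sub>R f x) \<xi> - g \<xi>))\<^sup>2) \<partial>lborel)
                \<longlonglongrightarrow> 0))"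

definition fourier :: "(real^'n \<Rightarrow> complex) \<Rightarrow> real^'n \<Rightarrow> complex" where
  "fourier = fourier_sign (- 1)"

definition inverse_fourier :: "(real^'n \<Rightarrow> complex) \<Rightarrow> real^'n \<Rightarrow> complex" where
  "inverse_fourier = fourier_sign 1"

(* Extension by zero outside Omega, then the transform of every component. *)
definition fourier_vec :: "(real^'n) set \<Rightarrow> (real^'n \<Rightarrow> real^'v) \<Rightarrow> real^'n \<Rightarrow> complex^'v" where
  "fourier_vec \<Omega> v \<xi> =
     (\<chi> i. fourier (\<lambda>x. complex_of_real (indicator \<Omega> x * v x $ i)) \<xi>)"

definition inverse_fourier_vec :: "(real^'n \<Rightarrow> complex^'v) \<Rightarrow> real^'n \<Rightarrow> complex^'v" where
  "inverse_fourier_vec h x = (\<chi> i. inverse_fourier (\<lambda>\<xi>. h \<xi> $ i) x)"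

definition fourier_mat :: "(real^'n \<Rightarrow> real^'v^'w) \<Rightarrow> real^'n \<Rightarrow> complex^'v^'w" where
  "fourier_mat \<kappa> \<xi> = (\<chi> i j. fourier (\<lambda>x. complex_of_real (\<kappa> x $ i $ j)) \<xi>)"


section \<open>Continuous-time Fourier neural operators\<close>

definition matrix_2norm :: "'a::real_normed_algebra_1^'m^'k \<Rightarrow> real" where
  "matrix_2norm A = onorm (\<lambda>x. A *v x)"

definition diag_matrix :: "real^'v \<Rightarrow> real^'v^'v" where
  "diag_matrix d = (\<chi> i j. if i = j then d $ i else 0)"

record ('n, 'v) fno_layer =
  weight :: "real^'v^'v"
  weight_mod :: "real \<Rightarrow> real^'v"  (* the diagonal of psi(t) *)
  kernel :: "real^'n \<Rightarrow> real^'v^'v"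
  fourier_mod :: "real \<Rightarrow> real^'n \<Rightarrow> complex"  (* phi(t, xi) *)

definition W_t :: "('n::finite, 'v::finite) fno_layer \<Rightarrow> real \<Rightarrow> real^'v^'v" where
  "W_t l t = weight l ** diag_matrix (weight_mod l t)"

definition R_t :: "('n::finite, 'v::finite) fno_layer \<Rightarrow> real \<Rightarrow> real^'n \<Rightarrow> complex^'v^'v" where
  "R_t l t \<xi> = (\<chi> i j. fourier_mod l t \<xi> * fourier_mat (kernel l) \<xi> $ i $ j)"

(* The conditions under which the formula for the layer makes sense on L2(Omega) at every time
   t >= 0: the kernel has a Fourier transform, and the function to which the inverse
   transform is applied lies in L2. *)
definition fno_layer_on :: "(real^'n) set \<Rightarrow> ('n::finite, 'v::finite) fno_layer \<Rightarrow> bool" where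
  "fno_layer_on \<Omega> l \<longleftrightarrow>
     (\<forall>i j. integrable lborel (\<lambda>x. kernel l x $ i $ j) \<or>
            square_integrable UNIV (\<lambda>x. kernel l x $ i $ j)) \<and>
     (\<forall>t\<ge>0. fourier_mod l t \<in> borel_measurable lborel) \<and>
     (\<forall>t\<ge>0. \<forall>v. square_integrable \<Omega> v \<longrightarrow>
            square_integrable UNIV (\<lambda>\<xi>. R_t l t \<xi> *v fourier_vec \<Omega> v \<xi>))"

(* As phi is complex-valued without a symmetry condition, the inverse transform need not be
   real; since sigma acts on reals, its real part is taken.  This changes nothing when the
   inverse transform is real. *)
definition layer_op ::
  "(real \<Rightarrow> real) \<Rightarrow> (real^'n) set \<Rightarrow> ('n::finite, 'v::finite) fno_layer \<Rightarrow> real \<Rightarrow>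
   (real^'n \<Rightarrow> real^'v) \<Rightarrow> real^'n \<Rightarrow> real^'v" where
  "layer_op \<sigma> \<Omega> l t v x =
     (\<chi> i. \<sigma> ((W_t l t *v v x) $ i +
        Re (inverse_fourier_vec (\<lambda>\<xi>. R_t l t \<xi> *v fourier_vec \<Omega> v \<xi>) x $ i)))"

(* The list of layers is [L_1, ..., L_L]; its first element is applied first. *)
definition ctfno ::
  "(real \<Rightarrow> real) \<Rightarrow> (real^'n) set \<Rightarrow> real^'a^'v \<Rightarrow> ('n::finite, 'v::finite) fno_layer list \<Rightarrow>
   real^'v^'u \<Rightarrow> real \<Rightarrow> (real^'n \<Rightarrow> real^'a) \<Rightarrow> real^'n \<Rightarrow> real^'u" where
  "ctfno \<sigma> \<Omega> P ls Q t u0 x =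
     Q *v fold (\<lambda>l v. layer_op \<sigma> \<Omega> l t v) ls (\<lambda>y. P *v u0 y) x"


section \<open>Stability\<close>

(* delta is chosen before t.  Membership in L2 is stated along with the bound because L2_norm
   is 0 on functions that are not square-integrable. *)
definition L2_stable ::
  "(real^'n) set \<Rightarrow> (real \<Rightarrow> (real^'n \<Rightarrow> real^'a) \<Rightarrow> real^'n \<Rightarrow> real^'u) \<Rightarrow> bool" where
  "L2_stable \<Omega> S \<longleftrightarrow>
     (\<forall>u0. square_integrable \<Omega> u0 \<longrightarrow>
       (\<forall>\<epsilon>>0. \<exists>\<delta>>0. \<forall>u0'. square_integrable \<Omega> u0' \<and> L2_norm \<Omega> (\<lambda>x. u0' x - u0 x) < \<delta> \<longrightarrow>
         (\<forall>t\<ge>0. square_integrable \<Omega> (\<lambda>x. S t u0' x - S t u0 x) \<and>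
                L2_norm \<Omega> (\<lambda>x. S t u0' x - S t u0 x) < \<epsilon>)))"

end

theory Submission
  imports Defs "HOL-Probability.Characteristic_Functions"
begin

text \<open>
  Every layer is Lipschitz on $L^2(\Omega)$ with a constant that does not depend on $t$; such maps
  compose, and a Lipschitz constant uniform in $t$ gives stability. The estimate of a layer rests
  on the Plancherel inequality $\|\mathcal{F}f\|_2 \le \|f\|_2$, obtained by integrating
  $|\mathcal{F}f|^2$ against Gaussians of growing width, whose transforms have mass $1$. For $t > 0$
  the multiplier $R(t,\cdot)$ is bounded by hypothesis. At $t = 0$ it need not be bounded, but it
  maps $\mathcal{F}(L^2(\Omega))$ into $L^2$, and the uniform boundedness principle for its
  truncations shows that it acts as a bounded operator.
\<close>

section \<open>The squared L2 norm\<close>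

text \<open>\<open>fourier_sign\<close> picks an L2 limit with \<open>SOME\<close>, so transforms of
  related functions need not be related pointwise. The inverse transform is therefore estimated only
  through energies of differences. The forward transform escapes this obstacle: Omega is bounded, so
  L2(Omega) lies in L1 and \<open>fourier_vec\<close> is a genuine integral, linear at every point.
  Norms are kept squared and with values in \<open>ennreal\<close>: \<open>energy\<close> then adds
  up over components, obeys the parallelogram law, fits Fatou's lemma and asks for no integrability.
  The price is a factor 2 in the triangle inequality, which is harmless because finitely many layers
  are composed and any finite Lipschitz constant gives stability.\<close>

definition energy :: "('a::euclidean_space \<Rightarrow> 'b::real_normed_vector) \<Rightarrow> ennreal" where
  "energy f = (\<integral>\<^sup>+ x. ennreal ((norm (f x))\<^sup>2) \<partial>lborel)"

lemma energy_cong: "(\<And>x. norm (f x) = norm (g x)) \<Longrightarrow> energy f = energy g"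
  unfolding energy_def by simp

lemma energy_mono_AE:
  assumes "AE x in lborel. norm (f x) \<le> norm (g x)"
  shows "energy f \<le> energy g"
  unfolding energy_def using assms
  by (intro nn_integral_mono_AE) (auto elim!: eventually_mono intro!: ennreal_leI power_mono)

lemma energy_zero [simp]: "energy (\<lambda>x. 0) = 0"
  by (simp add: energy_def)

lemma energy_scaleR:
  fixes f :: "'a::euclidean_space \<Rightarrow> 'b::euclidean_space"
  assumes [measurable]: "f \<in> borel_measurable borel"
  shows "energy (\<lambda>x. c *\<^sub>R f x) = ennreal (c\<^sup>2) * energy f"
  unfolding energy_def by (simp add: power_mult_distrib ennreal_mult nn_integral_cmult)

lemma norm_square_add_le:
  fixes x y :: "'a::real_normed_vector"
  shows "(norm (x + y))\<^sup>2 \<le> 2 * (norm x)\<^sup>2 + 2 * (norm y)\<^sup>2"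
proof -
  have "(norm (x + y))\<^sup>2 \<le> (norm x + norm y)\<^sup>2"
    by (intro power_mono norm_triangle_ineq) auto
  also have "\<dots> \<le> 2 * (norm x)\<^sup>2 + 2 * (norm y)\<^sup>2"
    using sum_squares_ge_zero[of "norm x - norm y" 0] by (simp add: power2_eq_square algebra_simps)
  finally show ?thesis .
qed

lemma energy_add_le:
  fixes f g :: "'a::euclidean_space \<Rightarrow> 'b::euclidean_space"
  assumes [measurable]: "f \<in> borel_measurable borel" "g \<in> borel_measurable borel"
  shows "energy (\<lambda>x. f x + g x) \<le> 2 * energy f + 2 * energy g"
proof -
  have "energy (\<lambda>x. f x + g x) \<le>
      (\<integral>\<^sup>+ x. 2 * ennreal ((norm (f x))\<^sup>2) + 2 * ennreal ((norm (g x))\<^sup>2) \<partial>lborel)"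
    unfolding energy_def
  proof (intro nn_integral_mono)
    fix x
    have "ennreal ((norm (f x + g x))\<^sup>2) \<le> ennreal (2 * (norm (f x))\<^sup>2 + 2 * (norm (g x))\<^sup>2)"
      by (intro ennreal_leI norm_square_add_le)
    then show "ennreal ((norm (f x + g x))\<^sup>2) \<le> 2 * ennreal ((norm (f x))\<^sup>2) + 2 * ennreal ((norm (g x))\<^sup>2)"
      by (simp add: ennreal_plus ennreal_mult)
  qed
  also have "\<dots> = 2 * energy f + 2 * energy g"
    unfolding energy_def by (simp add: nn_integral_add nn_integral_cmult)
  finally show ?thesis .
qed

lemma energy_diff_le:
  fixes f g :: "'a::euclidean_space \<Rightarrow> 'b::euclidean_space"
  assumes "f \<in> borel_measurable borel" "g \<in> borel_measurable borel"
  shows "energy (\<lambda>x. f x - g x) \<le> 2 * energy f + 2 * energy g"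
  using energy_add_le[of f "\<lambda>x. - g x"] assms energy_cong[of "\<lambda>x. - g x" g] by simp

text \<open>An identity, in contrast to \<open>energy_add_le\<close>. It is what lets the gliding
  hump argument choose a sign at each step.\<close>

lemma energy_parallelogram:
  fixes f g :: "'a::euclidean_space \<Rightarrow> 'b::euclidean_space"
  assumes [measurable]: "f \<in> borel_measurable borel" "g \<in> borel_measurable borel"
  shows "energy (\<lambda>x. f x + g x) + energy (\<lambda>x. f x - g x) = 2 * energy f + 2 * energy g"
proof -
  have "energy (\<lambda>x. f x + g x) + energy (\<lambda>x. f x - g x) =
     (\<integral>\<^sup>+ x. ennreal ((norm (f x + g x))\<^sup>2 + (norm (f x - g x))\<^sup>2) \<partial>lborel)"
    unfolding energy_def by (subst nn_integral_add[symmetric]) (auto simp: ennreal_plus)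
  also have "\<dots> = (\<integral>\<^sup>+ x. ennreal (2 * (norm (f x))\<^sup>2 + 2 * (norm (g x))\<^sup>2) \<partial>lborel)"
    by (simp add: power2_norm_eq_inner inner_add inner_diff inner_commute algebra_simps)
  also have "\<dots> = 2 * energy f + 2 * energy g"
    unfolding energy_def by (simp add: ennreal_plus ennreal_mult nn_integral_add nn_integral_cmult)
  finally show ?thesis .
qed

text \<open>The factor $4$ avoids Minkowski's inequality: with ratio $r \le 1/4$ the crude bound
  $\|f + g\|^2 \le 2\|f\|^2 + 2\|g\|^2$ suffices to sum the steps.\<close>

lemma energy_complete:
  fixes f :: "nat \<Rightarrow> 'a::euclidean_space \<Rightarrow> 'b::euclidean_space"
  assumes meas [measurable]: "\<And>k. f k \<in> borel_measurable borel"
    and step: "\<And>k. energy (\<lambda>x. f (Suc k) x - f k x) \<le> ennreal (A * r ^ k)"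
    and r: "0 \<le> r" "r \<le> 1 / 4" and A: "0 \<le> A"
  shows "\<exists>g\<in>borel_measurable borel. \<forall>k. energy (\<lambda>x. g x - f k x) \<le> ennreal (4 * A * r ^ k)"
proof -
  have block: "energy (\<lambda>x. f (k + m) x - f k x) \<le> ennreal (4 * A * r ^ k)" for k m
  proof (induction m arbitrary: k)
    case (Suc m)
    have "energy (\<lambda>x. f (k + Suc m) x - f k x) =
        energy (\<lambda>x. (f (Suc k + m) x - f (Suc k) x) + (f (Suc k) x - f k x))"
      by (intro energy_cong) simp
    also have "\<dots> \<le> 2 * energy (\<lambda>x. f (Suc k + m) x - f (Suc k) x) + 2 * energy (\<lambda>x. f (Suc k) x - f k x)"
      by (intro energy_add_le) auto
    also have "\<dots> \<le> 2 * ennreal (4 * A * r ^ Suc k) + 2 * ennreal (A * r ^ k)"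
      by (intro add_mono mult_left_mono step Suc.IH) auto
    \<comment> \<open>The factor 4 reproduces itself: 2 * 4 * r + 2 <= 4 exactly when r <=
      1/4.\<close>
    also have "\<dots> = ennreal ((8 * r + 2) * (A * r ^ k))"
      using r A by (simp add: ennreal_mult[symmetric] ennreal_plus[symmetric] del: ennreal_plus ennreal_mult')
        (simp add: algebra_simps flip: ennreal_numeral ennreal_mult' ennreal_plus)
    also have "\<dots> \<le> ennreal (4 * (A * r ^ k))"
      using r A by (intro ennreal_leI mult_right_mono) auto
    finally show ?case by (simp add: mult.assoc)
  qed (use r A in simp)
  \<comment> \<open>Where the sequence diverges \<open>lim\<close> is an unspecified value. The
    function is measurable all the same, and the divergence set turns out to be null.\<close>
  define g where "g x = lim (\<lambda>k. f k x)" for x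
  have [measurable]: "g \<in> borel_measurable borel"
    unfolding g_def[abs_def] by measurable
  \<comment> \<open>The weights 2^k leave the integrated series geometric, since 2 * r <= 1/2, and
    are large enough to recover summability of the unsquared steps below.\<close>
  have "(\<integral>\<^sup>+ x. (\<Sum>k. ennreal (2 ^ k * (norm (f (Suc k) x - f k x))\<^sup>2)) \<partial>lborel) =
      (\<Sum>k. ennreal (2 ^ k) * energy (\<lambda>x. f (Suc k) x - f k x))"
    unfolding energy_def
    by (subst nn_integral_suminf) (auto simp: ennreal_mult nn_integral_cmult)
  also have "\<dots> \<le> (\<Sum>k. ennreal (A * (1 / 2) ^ k))"
  proof (intro suminf_le allI)
    fix k
    have "ennreal (2 ^ k) * energy (\<lambda>x. f (Suc k) x - f k x) \<le> ennreal (2 ^ k) * ennreal (A * r ^ k)"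
      by (intro mult_left_mono step) auto
    also have "\<dots> = ennreal (A * (2 * r) ^ k)"
      using r A by (simp add: ennreal_mult[symmetric] power_mult_distrib mult_ac)
    also have "\<dots> \<le> ennreal (A * (1 / 2) ^ k)"
      using r A by (intro ennreal_leI mult_left_mono power_mono) auto
    finally show "ennreal (2 ^ k) * energy (\<lambda>x. f (Suc k) x - f k x) \<le> ennreal (A * (1 / 2) ^ k)" .
  qed auto
  also have "\<dots> < \<infinity>"
    using A by (subst suminf_ennreal2) (auto intro!: summable_mult)
  finally have fin: "(\<integral>\<^sup>+ x. (\<Sum>k. ennreal (2 ^ k * (norm (f (Suc k) x - f k x))\<^sup>2)) \<partial>lborel) \<noteq> \<infinity>"
    by simp
  have "AE x in lborel. (\<Sum>k. ennreal (2 ^ k * (norm (f (Suc k) x - f k x))\<^sup>2)) \<noteq> \<infinity>"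
    by (rule nn_integral_noteq_infinite[OF _ fin]) measurable
  then have lim: "AE x in lborel. (\<lambda>k. f k x) \<longlonglongrightarrow> g x"
  proof eventually_elim
    case (elim x)
    define d where "d k = f (Suc k) x - f k x" for k
    have 1: "summable (\<lambda>k. 2 ^ k * (norm (d k))\<^sup>2)"
      using elim unfolding d_def by (intro summable_suminf_not_top) auto
    have "summable (\<lambda>k. norm (d k))"
    proof (rule summable_comparison_test'[where N = 0])
      show "summable (\<lambda>k. 2 ^ k * (norm (d k))\<^sup>2 + (1 / 2) ^ k)"
        by (intro summable_add 1) auto
      fix k :: nat
      \<comment> \<open>AM-GM with weights: expanding the square gives 2 |d k| <= 2^k |d k|^2 +
        2^(-k).\<close>
      have "0 \<le> 2 ^ k * (norm (d k) - (1 / 2) ^ k)\<^sup>2" by simp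
      also have "\<dots> = 2 ^ k * (norm (d k))\<^sup>2 + (1 / 2) ^ k - 2 * norm (d k)"
        by (simp add: power2_eq_square field_simps)
      finally show "norm (norm (d k)) \<le> 2 ^ k * (norm (d k))\<^sup>2 + (1 / 2) ^ k"
        using norm_ge_zero[of "d k"] by (simp del: norm_ge_zero)
    qed
    then have "summable d" by (rule summable_norm_cancel)
    then have "convergent (\<lambda>n. \<Sum>k<n. d k)" by (simp add: summable_iff_convergent)
    moreover have "(\<lambda>n. f n x) = (\<lambda>n. f 0 x + (\<Sum>k<n. d k))"
      using sum_lessThan_telescope[of "\<lambda>k. f k x"] by (simp add: d_def)
    ultimately have "convergent (\<lambda>n. f n x)"
      using convergent_add[OF convergent_const] by simp
    then show ?case unfolding g_def by (simp add: convergent_LIMSEQ_iff)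
  qed
  have "energy (\<lambda>x. g x - f k x) \<le> ennreal (4 * A * r ^ k)" for k
  proof -
    \<comment> \<open>Fatou's lemma along the tail carries the bound \<open>block\<close>, which is
      uniform in m, over to the limit.\<close>
    have "energy (\<lambda>x. g x - f k x) =
        (\<integral>\<^sup>+ x. liminf (\<lambda>m. ennreal ((norm (f (k + m) x - f k x))\<^sup>2)) \<partial>lborel)"
      unfolding energy_def
    proof (intro nn_integral_cong_AE, use lim in eventually_elim)
      case (elim x)
      have "(\<lambda>m. f (k + m) x) \<longlonglongrightarrow> g x"
        using LIMSEQ_ignore_initial_segment[OF elim, of k] by (simp add: add.commute)
      then have "(\<lambda>m. ennreal ((norm (f (k + m) x - f k x))\<^sup>2)) \<longlonglongrightarrow> ennreal ((norm (g x - f k x))\<^sup>2)"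
        by (intro tendsto_intros)
      then show ?case by (rule lim_imp_Liminf[OF sequentially_bot, symmetric])
    qed
    also have "\<dots> \<le> liminf (\<lambda>m. energy (\<lambda>x. f (k + m) x - f k x))"
      unfolding energy_def by (intro nn_integral_liminf) measurable
    also have "\<dots> \<le> liminf (\<lambda>m::nat. ennreal (4 * A * r ^ k))"
      by (intro Liminf_mono always_eventually allI block)
    finally show ?thesis by (simp add: Liminf_const)
  qed
  then show ?thesis by (intro bexI[of _ g]) auto
qed


section \<open>The Plancherel inequality\<close>

text \<open>The substitution y = a * s turns this into the characteristic function of the standard
  normal distribution at u / a. The factor sqrt (2 * pi) undoes the normalization of the density,
  and 1 / a is the Jacobian.\<close>

lemma gaussian_fourier_real:
  fixes a u :: real
  assumes a: "0 < a"
  shows "integrable lborel (\<lambda>s. complex_of_real (exp (- (a * s)\<^sup>2 / 2)) * cis (u * s))" (is "integrable _ ?f")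
    and "(LINT s|lborel. complex_of_real (exp (- (a * s)\<^sup>2 / 2)) * cis (u * s)) =
      complex_of_real (sqrt (2 * pi) / a * exp (- (u / a)\<^sup>2 / 2))"
proof -
  define g where "g x = std_normal_density x *\<^sub>R cis (u / a * x)" for x
  have ig: "integrable lborel g"
    unfolding g_def
  proof (rule Bochner_Integration.integrable_bound[OF integrable_normal_density[of 1 0]])
    show "(\<lambda>x. std_normal_density x *\<^sub>R cis (u / a * x)) \<in> borel_measurable lborel"
      by (auto intro!: borel_measurable_continuous_onI continuous_intros simp: cis_conv_exp)
  qed (auto simp: normal_density_nonneg)
  have "char std_normal_distribution (u / a) = (LINT x|lborel. g x)"
    unfolding char_def g_def
    by (subst integral_density)
       (auto simp: cis_conv_exp normal_density_nonneg intro!: borel_measurable_continuous_onI continuous_intros)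
  then have "(LINT x|lborel. g x) = exp (- (u / a)\<^sup>2 / 2)"
    by (simp add: char_std_normal_distribution)
  then have 1: "has_bochner_integral lborel g (complex_of_real (exp (- (u / a)\<^sup>2 / 2)))"
    using ig by (simp add: has_bochner_integral_iff)
  \<comment> \<open>The summand 0 gives the argument the affine shape that the substitution rule for
    \<open>lborel\<close> expects.\<close>
  have eq: "?f = (\<lambda>s. sqrt (2 * pi) *\<^sub>R g (0 + a * s))"
    using a by (auto simp: fun_eq_iff g_def std_normal_density_def scaleR_conv_of_real field_simps)
  have "has_bochner_integral lborel ?f (sqrt (2 * pi) *\<^sub>R (complex_of_real (exp (- (u / a)\<^sup>2 / 2)) /\<^sub>R \<bar>a\<bar>))"
    unfolding eq using 1 a
    by (intro has_bochner_integral_scaleR_right)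
       (subst lborel_has_bochner_integral_real_affine_iff[symmetric], auto)
  then show "integrable lborel ?f" "(LINT s|lborel. ?f s) =
      complex_of_real (sqrt (2 * pi) / a * exp (- (u / a)\<^sup>2 / 2))"
    using a by (auto simp: has_bochner_integral_iff scaleR_conv_of_real field_simps)
qed

lemma cis_sum: "finite A \<Longrightarrow> cis (\<Sum>b\<in>A. f b) = (\<Prod>b\<in>A. cis (f b))"
  by (induction A rule: finite_induct) (auto simp: cis_mult[symmetric])

text \<open>\<open>lborel\<close> is the image of a product measure indexed by \<open>Basis\<close>,
  so this is Fubini's theorem for product functions, carried along that image.\<close>

lemma lborel_integral_prod:
  fixes f :: "'a::euclidean_space \<Rightarrow> real \<Rightarrow> 'b::{real_normed_field,banach,second_countable_topology}"
  assumes f: "\<And>b. b \<in> Basis \<Longrightarrow> integrable lborel (f b)"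
  shows "integrable lborel (\<lambda>x. \<Prod>b\<in>Basis. f b (x \<bullet> b))"
    and "(LINT x|lborel. (\<Prod>b\<in>Basis. f b (x \<bullet> b))) = (\<Prod>b\<in>Basis. LINT s|lborel. f b s)"
proof -
  interpret product_sigma_finite "\<lambda>_::'a. lborel :: real measure" ..
  have [measurable]: "f b \<in> borel_measurable borel" if "b \<in> Basis" for b
    using borel_measurable_integrable[OF f[OF that]] by simp
  have m: "(\<lambda>x. \<Prod>b\<in>Basis. f b (x \<bullet> b)) \<in> borel_measurable borel" by measurable
  have eq: "(\<Prod>b\<in>Basis. f b ((\<Sum>b\<in>Basis. x b *\<^sub>R b) \<bullet> b)) = (\<Prod>b\<in>Basis. f b (x b))" for x
    by (auto intro!: prod.cong)
  show "integrable lborel (\<lambda>x. \<Prod>b\<in>Basis. f b (x \<bullet> b))"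
    by (subst lborel_eq) (auto simp: integrable_distr_eq m eq intro!: product_integrable_prod f)
  show "(LINT x|lborel. (\<Prod>b\<in>Basis. f b (x \<bullet> b))) = (\<Prod>b\<in>Basis. LINT s|lborel. f b s)"
    by (subst lborel_eq) (auto simp: integral_distr m eq intro!: product_integral_prod f)
qed

text \<open>In closed form (2 pi)^(n/2) / a^n * exp (- |z|^2 / (2 a^2)) in dimension n. The product
  over coordinates is kept because both the transform and the total mass are computed one factor at
  a time.\<close>

definition gaussian_transform :: "real \<Rightarrow> 'a::euclidean_space \<Rightarrow> real" where
  "gaussian_transform a z = (\<Prod>b\<in>Basis. sqrt (2 * pi) / a * exp (- (z \<bullet> b / a)\<^sup>2 / 2))"

lemma gaussian_fourier:
  fixes z :: "'a::euclidean_space"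
  assumes a: "0 < a"
  shows "integrable lborel (\<lambda>\<xi>. complex_of_real (exp (- (a * norm \<xi>)\<^sup>2 / 2)) * cis (z \<bullet> \<xi>))"
    and "(LINT \<xi>|lborel. complex_of_real (exp (- (a * norm \<xi>)\<^sup>2 / 2)) * cis (z \<bullet> \<xi>)) =
      complex_of_real (gaussian_transform a z)"
proof -
  define f where "f b s = complex_of_real (exp (- (a * s)\<^sup>2 / 2)) * cis ((z \<bullet> b) * s)" for b s
  have eq: "complex_of_real (exp (- (a * norm \<xi>)\<^sup>2 / 2)) * cis (z \<bullet> \<xi>) =
    (\<Prod>b\<in>Basis. f b (\<xi> \<bullet> b))" for \<xi>
  proof -
    have "(norm \<xi>)\<^sup>2 = (\<Sum>b\<in>Basis. (\<xi> \<bullet> b)\<^sup>2)"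
      by (simp only: power2_norm_eq_inner) (subst euclidean_inner, simp add: power2_eq_square)
    then have "exp (- (a * norm \<xi>)\<^sup>2 / 2) = (\<Prod>b\<in>Basis. exp (- (a * (\<xi> \<bullet> b))\<^sup>2 / 2))"
      by (simp add: exp_sum[symmetric] power_mult_distrib sum_distrib_left sum_negf sum_divide_distrib)
    moreover have "cis (z \<bullet> \<xi>) = (\<Prod>b\<in>Basis. cis ((z \<bullet> b) * (\<xi> \<bullet> b)))"
      by (subst euclidean_inner) (simp add: cis_sum)
    ultimately show ?thesis
      by (simp add: f_def prod.distrib)
  qed
  have i: "integrable lborel (f b)" for b
    unfolding f_def by (rule gaussian_fourier_real[OF a])
  show "integrable lborel (\<lambda>\<xi>. complex_of_real (exp (- (a * norm \<xi>)\<^sup>2 / 2)) * cis (z \<bullet> \<xi>))"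
    unfolding eq by (rule lborel_integral_prod[OF i])
  show "(LINT \<xi>|lborel. complex_of_real (exp (- (a * norm \<xi>)\<^sup>2 / 2)) * cis (z \<bullet> \<xi>)) =
      complex_of_real (gaussian_transform a z)"
    unfolding eq gaussian_transform_def lborel_integral_prod(2)[OF i]
    unfolding f_def gaussian_fourier_real(2)[OF a] by simp
qed

lemma gaussian_transform_nonneg: "0 < a \<Longrightarrow> 0 \<le> gaussian_transform a z"
  unfolding gaussian_transform_def by (intro prod_nonneg) auto

lemma borel_measurable_gaussian_transform [measurable]:
  "gaussian_transform a \<in> borel_measurable borel"
  unfolding gaussian_transform_def[abs_def] by measurable

text \<open>At 2 * pi * x each factor is the density of a normal distribution with standard
  deviation a / (2 * pi). The factor 2 * pi in the exponent of the Fourier integral is thus what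
  makes the mass exactly 1, for every a.\<close>

lemma nn_integral_gaussian_transform:
  assumes a: "0 < a"
  shows "(\<integral>\<^sup>+ (x::'a::euclidean_space). ennreal (gaussian_transform a ((2 * pi) *\<^sub>R x)) \<partial>lborel) = 1"
proof -
  have eq: "sqrt (2 * pi) / a * exp (- (2 * pi * s / a)\<^sup>2 / 2) = normal_density 0 (a / (2 * pi)) s" for s
  proof -
    have s: "sqrt (2 * pi * (a / (2 * pi))\<^sup>2) = a / sqrt (2 * pi)"
    proof -
      have "2 * pi * (a / (2 * pi))\<^sup>2 = a\<^sup>2 / (2 * pi)"
        by (simp add: power2_eq_square field_simps)
      then show ?thesis using a by (simp add: real_sqrt_divide)
    qed
    show ?thesis
      unfolding normal_density_def s using a by (simp add: power_divide power_mult_distrib field_simps)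
  qed
  have 1: "(\<integral>\<^sup>+ s. ennreal (normal_density 0 (a / (2 * pi)) s) \<partial>lborel) = 1"
    using prob_space.emeasure_space_1[OF prob_space_normal_density[of "a / (2 * pi)" 0]] a
    by (simp add: emeasure_density)
  have "gaussian_transform a ((2 * pi) *\<^sub>R x) = (\<Prod>b\<in>Basis. normal_density 0 (a / (2 * pi)) (x \<bullet> b))" for x :: 'a
    unfolding gaussian_transform_def eq[symmetric] by simp
  then have "(\<integral>\<^sup>+ (x::'a). ennreal (gaussian_transform a ((2 * pi) *\<^sub>R x)) \<partial>lborel) =
     (\<integral>\<^sup>+ (x::'a). (\<Prod>b\<in>Basis. ennreal (normal_density 0 (a / (2 * pi)) (x \<bullet> b))) \<partial>lborel)"
    by (simp add: prod_ennreal normal_density_nonneg)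
  also have "\<dots> = 1"
    by (subst nn_integral_lborel_prod) (auto simp: 1 normal_density_nonneg)
  finally show ?thesis .
qed


lemma gaussian_transform_minus: "gaussian_transform a (- z) = gaussian_transform a z"
  by (simp add: gaussian_transform_def)

text \<open>The kernel on pairs (x, y) has mass 1 in either variable when the other is fixed, as a
  Schur test requires. The sign s covers the transform and its inverse together.\<close>

lemma nn_integral_gaussian_transform_shift:
  fixes x :: "'a::euclidean_space"
  assumes "0 < a" "\<bar>s\<bar> = 1"
  shows "(\<integral>\<^sup>+ y. ennreal (gaussian_transform a ((s * (2 * pi)) *\<^sub>R (x - y))) \<partial>lborel) = 1"
    and "(\<integral>\<^sup>+ y. ennreal (gaussian_transform a ((s * (2 * pi)) *\<^sub>R (y - x))) \<partial>lborel) = 1"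
proof -
  have s: "s = 1 \<or> s = - 1" using assms(2) by linarith
  have 1: "(\<integral>\<^sup>+ y. ennreal (gaussian_transform a ((2 * pi) *\<^sub>R (- x + y))) \<partial>lborel) = 1"
    using nn_integral_gaussian_transform[OF assms(1), where 'a='a]
      nn_integral_distr[of "(+) (- x)" lborel borel "\<lambda>y. ennreal (gaussian_transform a ((2 * pi) *\<^sub>R y))"]
    by (simp add: lborel_distr_plus)
  have 2: "gaussian_transform a ((2 * pi) *\<^sub>R (x - y)) = gaussian_transform a ((2 * pi) *\<^sub>R (- x + y))" for y
    using gaussian_transform_minus[of a "(2 * pi) *\<^sub>R (x - y)"] by (simp add: algebra_simps)
  have 3: "gaussian_transform a (- ((2 * pi) *\<^sub>R z)) = gaussian_transform a ((2 * pi) *\<^sub>R z)" for z :: 'a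
    by (rule gaussian_transform_minus)
  show "(\<integral>\<^sup>+ y. ennreal (gaussian_transform a ((s * (2 * pi)) *\<^sub>R (x - y))) \<partial>lborel) = 1"
    using s 1 by (auto simp: 2 3)
  show "(\<integral>\<^sup>+ y. ennreal (gaussian_transform a ((s * (2 * pi)) *\<^sub>R (y - x))) \<partial>lborel) = 1"
    using s 1 by (auto simp: 3)
qed

section \<open>Measurability and integrability of Fourier integrals\<close>

lemma borel_measurable_cis [measurable]: "cis \<in> borel_measurable borel"
  by (intro borel_measurable_continuous_onI) (simp add: cis_conv_exp continuous_intros)

lemma borel_measurable_cnj [measurable]: "cnj \<in> borel_measurable borel"
  by (intro borel_measurable_continuous_onI continuous_intros)

lemma integrable_fourier_integrand:
  assumes "integrable lborel f"
  shows "integrable lborel (\<lambda>x. f x * cis (s * 2 * pi * (x \<bullet> \<xi>)))"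
proof (rule Bochner_Integration.integrable_bound[OF assms])
  have [measurable]: "f \<in> borel_measurable borel" using assms by auto
  show "(\<lambda>x. f x * cis (s * 2 * pi * (x \<bullet> \<xi>))) \<in> borel_measurable lborel" by measurable
qed (simp add: norm_mult)

lemma borel_measurable_fourier_integral:
  assumes "f \<in> borel_measurable borel"
  shows "fourier_integral s f \<in> borel_measurable borel"
proof -
  have [measurable]: "f \<in> borel_measurable lborel" using assms by simp
  have "(\<lambda>\<xi>. LINT x|lborel. f x * cis (s * 2 * pi * (x \<bullet> \<xi>))) \<in> borel_measurable borel"
    by measurable
  then show ?thesis unfolding fourier_integral_def[abs_def] .
qed

text \<open>Write the squared modulus of the transform as a double integral of f(x) times the
  conjugate of f(y). Integrating first over the frequency leaves the nonnegative kernel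
  \<open>gaussian_transform\<close> at a multiple of x - y. A Schur test, with mass 1 in each
  variable, bounds the result by the energy of f independently of a.\<close>

lemma energy_fourier_integral_weighted_le:
  fixes f :: "real^'n \<Rightarrow> complex"
  assumes f: "integrable lborel f" and s: "\<bar>s\<bar> = 1" and a: "0 < a"
  shows "(\<integral>\<^sup>+ \<xi>. ennreal ((cmod (fourier_integral s f \<xi>))\<^sup>2 * exp (- (a * norm \<xi>)\<^sup>2 / 2)) \<partial>lborel) \<le> energy f"
proof -
  interpret Q: pair_sigma_finite "lborel \<Otimes>\<^sub>M lborel :: ((real^'n) \<times> (real^'n)) measure" "lborel :: (real^'n) measure" ..
  have mf [measurable]: "f \<in> borel_measurable borel" using f by auto
  define w where "w \<xi> = exp (- (a * norm \<xi>)\<^sup>2 / 2)" for \<xi> :: "real^'n"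
  have [measurable]: "w \<in> borel_measurable borel" unfolding w_def[abs_def] by measurable
  have w_pos: "0 \<le> w \<xi>" for \<xi> by (simp add: w_def)
  have iw: "integrable lborel (\<lambda>\<xi>. complex_of_real (w \<xi>))"
    using gaussian_fourier(1)[OF a, of "0 :: real^'n"] by (simp add: w_def)
  \<comment> \<open>This is where f in L1 enters. Together with the integrable Gaussian it makes the
    triple integral absolutely convergent, so Fubini applies.\<close>
  have ff: "integrable (lborel \<Otimes>\<^sub>M lborel) (\<lambda>p. f (fst p) * cnj (f (snd p)))"
  proof (rule lborel_pair.Fubini_integrable)
    have "integrable lborel (\<lambda>x. cmod (f x) * (LINT y|lborel. cmod (f y)))"
      using f by (intro integrable_mult_left) auto
    then show "integrable lborel (\<lambda>x. LINT y|lborel. norm (f (fst (x, y)) * cnj (f (snd (x, y)))))"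
      by (simp add: norm_mult)
  next
    show "(\<lambda>p. f (fst p) * cnj (f (snd p))) \<in> borel_measurable (lborel \<Otimes>\<^sub>M lborel)"
      by measurable
  qed (use f in \<open>auto intro!: AE_I2 integrable_mult_right\<close>)
  define h where "h p \<xi> = f (fst p) * cnj (f (snd p)) * (complex_of_real (w \<xi>) *
      cis ((s * (2 * pi)) *\<^sub>R (fst p - snd p) \<bullet> \<xi>))" for p \<xi>
  have mh: "case_prod h \<in> borel_measurable ((lborel \<Otimes>\<^sub>M lborel) \<Otimes>\<^sub>M lborel)"
    unfolding h_def[abs_def] by measurable
  have nh: "norm (h p \<xi>) = norm (f (fst p) * cnj (f (snd p))) * w \<xi>" for p \<xi>
    by (simp add: h_def norm_mult w_pos)
  have h_int: "integrable lborel (h p)" for p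
    unfolding h_def w_def by (intro integrable_mult_right gaussian_fourier[OF a])
  have ih: "integrable ((lborel \<Otimes>\<^sub>M lborel) \<Otimes>\<^sub>M lborel) (case_prod h)"
  proof (rule Q.Fubini_integrable[OF mh])
    have "integrable (lborel \<Otimes>\<^sub>M lborel)
        (\<lambda>p. norm (f (fst p) * cnj (f (snd p))) * (LINT \<xi>|(lborel :: (real^'n) measure). w \<xi>))"
      by (intro integrable_mult_left integrable_norm ff)
    then show "integrable (lborel \<Otimes>\<^sub>M lborel) (\<lambda>p. LINT \<xi>|lborel. norm (case (p, \<xi>) of (p, \<xi>) \<Rightarrow> h p \<xi>))"
      by (simp add: nh)
  qed (simp add: h_int)
  have inner1: "(LINT \<xi>|lborel. h p \<xi>) = f (fst p) * cnj (f (snd p)) *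
      complex_of_real (gaussian_transform a ((s * (2 * pi)) *\<^sub>R (fst p - snd p)))" for p
    unfolding h_def w_def by (subst integral_mult_right_zero, subst gaussian_fourier(2)[OF a]) simp
  \<comment> \<open>For a fixed frequency the character of x - y splits into a character of x times
    the conjugate of that of y, so the double integral is the transform times its own
    conjugate.\<close>
  have inner2: "(LINT p|(lborel \<Otimes>\<^sub>M lborel). h p \<xi>) = complex_of_real ((cmod (fourier_integral s f \<xi>))\<^sup>2 * w \<xi>)" for \<xi>
  proof -
    define e where "e x = f x * cis (s * 2 * pi * (x \<bullet> \<xi>))" for x
    have e_int: "integrable lborel e"
      unfolding e_def by (rule integrable_fourier_integrand[OF f])
    have h_eq: "h p \<xi> = complex_of_real (w \<xi>) * (e (fst p) * cnj (e (snd p)))" for p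
      by (simp add: h_def e_def cis_cnj inner_diff_left algebra_simps divide_inverse flip: cis_divide)
    have ie: "integrable (lborel \<Otimes>\<^sub>M lborel) (\<lambda>p. e (fst p) * cnj (e (snd p)))"
      by (rule Bochner_Integration.integrable_bound[OF ff])
         (auto simp: e_def norm_mult)
    have "(LINT p|(lborel \<Otimes>\<^sub>M lborel). e (fst p) * cnj (e (snd p))) =
        (LINT x|lborel. LINT y|lborel. e x * cnj (e y))"
      using lborel_pair.integral_fst'[OF ie] by simp
    also have "\<dots> = (LINT x|lborel. e x) * cnj (LINT y|lborel. e y)"
      by simp
    also have "\<dots> = complex_of_real ((cmod (fourier_integral s f \<xi>))\<^sup>2)"
      unfolding fourier_integral_def e_def by (rule complex_norm_square[symmetric])
    finally show ?thesis
      unfolding h_eq by simp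
  qed
  have swap: "complex_of_real (LINT \<xi>|lborel. (cmod (fourier_integral s f \<xi>))\<^sup>2 * w \<xi>) =
      (LINT p|(lborel \<Otimes>\<^sub>M lborel). f (fst p) * cnj (f (snd p)) *
        complex_of_real (gaussian_transform a ((s * (2 * pi)) *\<^sub>R (fst p - snd p))))" (is "_ = integral\<^sup>L _ ?k")
    using Q.Fubini_integral[OF ih] by (simp add: inner1 inner2 del: of_real_mult of_real_power)
  have ik: "integrable (lborel \<Otimes>\<^sub>M lborel) ?k"
    using Q.integrable_fst[OF ih] by (simp add: inner1)
  have "integrable lborel (\<lambda>\<xi>. complex_of_real ((cmod (fourier_integral s f \<xi>))\<^sup>2 * w \<xi>))"
    using Q.integrable_snd[OF ih] by (simp add: inner2 del: of_real_mult of_real_power)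
  then have "integrable lborel (\<lambda>\<xi>. (cmod (fourier_integral s f \<xi>))\<^sup>2 * w \<xi>)"
    by (simp only: complex_of_real_integrable_eq)
  then have "(\<integral>\<^sup>+ \<xi>. ennreal ((cmod (fourier_integral s f \<xi>))\<^sup>2 * w \<xi>) \<partial>lborel) =
      ennreal (LINT \<xi>|lborel. (cmod (fourier_integral s f \<xi>))\<^sup>2 * w \<xi>)"
    by (intro nn_integral_eq_integral) (auto simp: w_pos)
  \<comment> \<open>The weighted integral is a nonnegative real, hence equal to the norm of the
    complex double integral, and the triangle inequality for integrals becomes available.\<close>
  also have "\<dots> = ennreal (norm (integral\<^sup>L (lborel \<Otimes>\<^sub>M lborel) ?k))"
    unfolding swap[symmetric] by (simp add: w_pos integral_nonneg_AE)
  also have "\<dots> \<le> (\<integral>\<^sup>+ p. ennreal (norm (?k p)) \<partial>(lborel \<Otimes>\<^sub>M lborel))"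
    by (rule integral_norm_bound_ennreal[OF ik])
  \<comment> \<open>By a * b <= a^2 / 2 + b^2 / 2 each summand involves f at only one of the two
    points, so the other variable can be integrated out of the kernel.\<close>
  also have "\<dots> \<le> (\<integral>\<^sup>+ p. ennreal ((cmod (f (fst p)))\<^sup>2 / 2) * ennreal (gaussian_transform a ((s * (2 * pi)) *\<^sub>R (fst p - snd p))) +
       ennreal ((cmod (f (snd p)))\<^sup>2 / 2) * ennreal (gaussian_transform a ((s * (2 * pi)) *\<^sub>R (fst p - snd p))) \<partial>(lborel \<Otimes>\<^sub>M lborel))"
  proof (intro nn_integral_mono)
    fix p :: "(real^'n) \<times> (real^'n)"
    let ?g = "gaussian_transform a ((s * (2 * pi)) *\<^sub>R (fst p - snd p))"
    have g: "0 \<le> ?g" by (rule gaussian_transform_nonneg[OF a])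
    have "cmod (f (fst p)) * cmod (f (snd p)) \<le> (cmod (f (fst p)))\<^sup>2 / 2 + (cmod (f (snd p)))\<^sup>2 / 2"
      using sum_squares_bound[of "cmod (f (fst p))" "cmod (f (snd p))"] by simp
    then have "cmod (f (fst p)) * cmod (f (snd p)) * ?g \<le> ((cmod (f (fst p)))\<^sup>2 / 2 + (cmod (f (snd p)))\<^sup>2 / 2) * ?g"
      by (rule mult_right_mono[OF _ g])
    then have "ennreal (norm (?k p)) \<le> ennreal ((cmod (f (fst p)))\<^sup>2 / 2 * ?g + (cmod (f (snd p)))\<^sup>2 / 2 * ?g)"
      using g by (intro ennreal_leI) (simp add: norm_mult distrib_right)
    then show "ennreal (norm (?k p)) \<le> ennreal ((cmod (f (fst p)))\<^sup>2 / 2) * ennreal ?g + ennreal ((cmod (f (snd p)))\<^sup>2 / 2) * ennreal ?g"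
      using g by (simp add: ennreal_mult[symmetric] ennreal_plus[symmetric] del: ennreal_plus)
  qed
  also have "\<dots> = (\<integral>\<^sup>+ x. ennreal ((cmod (f x))\<^sup>2 / 2) \<partial>lborel) + (\<integral>\<^sup>+ x. ennreal ((cmod (f x))\<^sup>2 / 2) \<partial>lborel)"
  proof (subst nn_integral_add)
    have "(\<integral>\<^sup>+ p. ennreal ((cmod (f (fst p)))\<^sup>2 / 2) * ennreal (gaussian_transform a ((s * (2 * pi)) *\<^sub>R (fst p - snd p))) \<partial>(lborel \<Otimes>\<^sub>M lborel)) =
       (\<integral>\<^sup>+ x. ennreal ((cmod (f x))\<^sup>2 / 2) \<partial>lborel)"
      by (subst lborel.nn_integral_fst[symmetric], measurable)
         (simp add: nn_integral_cmult nn_integral_gaussian_transform_shift[OF a s] del: scaleR_right_diff_distrib)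
    moreover have "(\<integral>\<^sup>+ p. ennreal ((cmod (f (snd p)))\<^sup>2 / 2) * ennreal (gaussian_transform a ((s * (2 * pi)) *\<^sub>R (fst p - snd p))) \<partial>(lborel \<Otimes>\<^sub>M lborel)) =
       (\<integral>\<^sup>+ x. ennreal ((cmod (f x))\<^sup>2 / 2) \<partial>lborel)"
      by (subst lborel_pair.nn_integral_snd[symmetric], measurable)
         (simp add: nn_integral_cmult nn_integral_gaussian_transform_shift[OF a s])
    ultimately show "(\<integral>\<^sup>+ p. ennreal ((cmod (f (fst p)))\<^sup>2 / 2) * ennreal (gaussian_transform a ((s * (2 * pi)) *\<^sub>R (fst p - snd p))) \<partial>(lborel \<Otimes>\<^sub>M lborel)) +
      (\<integral>\<^sup>+ p. ennreal ((cmod (f (snd p)))\<^sup>2 / 2) * ennreal (gaussian_transform a ((s * (2 * pi)) *\<^sub>R (fst p - snd p))) \<partial>(lborel \<Otimes>\<^sub>M lborel)) =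
      (\<integral>\<^sup>+ x. ennreal ((cmod (f x))\<^sup>2 / 2) \<partial>lborel) + (\<integral>\<^sup>+ x. ennreal ((cmod (f x))\<^sup>2 / 2) \<partial>lborel)"
      by simp
  qed measurable
  also have "\<dots> = energy f"
    unfolding energy_def by (subst nn_integral_add[symmetric]) (auto simp flip: ennreal_plus)
  finally show ?thesis by (simp add: w_def)
qed

text \<open>The weighted bound does not depend on a. Fatou's lemma along a = 1 / (k + 1) removes the
  weight, which tends to 1 at every frequency.\<close>

lemma energy_fourier_integral_le:
  fixes f :: "real^'n \<Rightarrow> complex"
  assumes f: "integrable lborel f" and s: "\<bar>s\<bar> = 1"
  shows "energy (fourier_integral s f) \<le> energy f"
proof -
  have [measurable]: "fourier_integral s f \<in> borel_measurable borel"
    using f by (intro borel_measurable_fourier_integral) auto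
  let ?w = "\<lambda>k \<xi>. (cmod (fourier_integral s f \<xi>))\<^sup>2 * exp (- (1 / real (Suc k) * norm \<xi>)\<^sup>2 / 2)"
  have "energy (fourier_integral s f) = (\<integral>\<^sup>+ \<xi>. liminf (\<lambda>k. ennreal (?w k \<xi>)) \<partial>lborel)"
    unfolding energy_def
  proof (intro nn_integral_cong)
    fix \<xi> :: "real^'n"
    have "(\<lambda>k. 1 / real (Suc k)) \<longlonglongrightarrow> 0"
      using LIMSEQ_inverse_real_of_nat by (simp add: inverse_eq_divide)
    then have "(\<lambda>k. ?w k \<xi>) \<longlonglongrightarrow> (cmod (fourier_integral s f \<xi>))\<^sup>2 * exp (- (0 * norm \<xi>)\<^sup>2 / 2)"
      by (intro tendsto_intros) simp_all
    then have "(\<lambda>k. ennreal (?w k \<xi>)) \<longlonglongrightarrow> ennreal ((cmod (fourier_integral s f \<xi>))\<^sup>2)"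
      by (intro tendsto_ennrealI) simp
    then show "ennreal ((cmod (fourier_integral s f \<xi>))\<^sup>2) = liminf (\<lambda>k. ennreal (?w k \<xi>))"
      by (rule lim_imp_Liminf[OF sequentially_bot, symmetric])
  qed
  also have "\<dots> \<le> liminf (\<lambda>k. \<integral>\<^sup>+ \<xi>. ennreal (?w k \<xi>) \<partial>lborel)"
    by (intro nn_integral_liminf) measurable
  also have "\<dots> \<le> liminf (\<lambda>k::nat. energy f)"
    by (intro Liminf_mono always_eventually allI energy_fourier_integral_weighted_le[OF f s]) simp
  finally show ?thesis by (simp add: Liminf_const)
qed


section \<open>The Fourier transform on L2\<close>

text \<open>Values off Omega carry no meaning and may even be nonmeasurable. Cutting them off turns
  statements on L2(Omega) into global ones about Borel functions and \<open>energy\<close>.\<close>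

definition zero_ext :: "'a set \<Rightarrow> ('a \<Rightarrow> 'b::real_vector) \<Rightarrow> 'a \<Rightarrow> 'b" where
  "zero_ext \<Omega> f = (\<lambda>x. indicator \<Omega> x *\<^sub>R f x)"

lemma zero_ext_diff: "zero_ext \<Omega> (\<lambda>x. f x - g x) = (\<lambda>x. zero_ext \<Omega> f x - zero_ext \<Omega> g x)"
  by (simp add: zero_ext_def scaleR_diff_right)

lemma norm_zero_ext_square:
  fixes f :: "'a \<Rightarrow> 'b::real_normed_vector"
  shows "(norm (zero_ext \<Omega> f x))\<^sup>2 = indicator \<Omega> x * (norm (f x))\<^sup>2"
  by (simp add: zero_ext_def indicator_def)

lemma square_integrable_iff:
  fixes f :: "real^'n \<Rightarrow> 'b::euclidean_space"
  shows "square_integrable \<Omega> f \<longleftrightarrow> zero_ext \<Omega> f \<in> borel_measurable borel \<and> energy (zero_ext \<Omega> f) < \<infinity>"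
proof -
  have "integrable lborel (\<lambda>x. (norm (zero_ext \<Omega> f x))\<^sup>2) \<longleftrightarrow> energy (zero_ext \<Omega> f) < \<infinity>"
    if [measurable]: "zero_ext \<Omega> f \<in> borel_measurable borel"
    unfolding energy_def integrable_iff_bounded by simp
  then show ?thesis
    unfolding square_integrable_def set_borel_measurable_def set_integrable_def
    by (auto simp: norm_zero_ext_square zero_ext_def[symmetric])
qed

lemma square_integrable_UNIV_iff:
  fixes f :: "real^'n \<Rightarrow> 'b::euclidean_space"
  shows "square_integrable UNIV f \<longleftrightarrow> f \<in> borel_measurable borel \<and> energy f < \<infinity>"
  by (simp add: square_integrable_iff zero_ext_def)

lemma L2_norm_eq:
  fixes f :: "real^'n \<Rightarrow> 'b::euclidean_space"
  assumes "square_integrable \<Omega> f"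
  shows "ennreal ((L2_norm \<Omega> f)\<^sup>2) = energy (zero_ext \<Omega> f)"
proof -
  have [measurable]: "zero_ext \<Omega> f \<in> borel_measurable borel" and fin: "energy (zero_ext \<Omega> f) < \<infinity>"
    using assms by (auto simp: square_integrable_iff)
  have "(L2_norm \<Omega> f)\<^sup>2 = (LINT x|lborel. (norm (zero_ext \<Omega> f x))\<^sup>2)"
    unfolding L2_norm_def set_lebesgue_integral_def norm_zero_ext_square
    by (simp add: integral_nonneg_AE)
  also have "\<dots> = enn2real (energy (zero_ext \<Omega> f))"
    unfolding energy_def by (intro integral_eq_nn_integral) auto
  finally show ?thesis using fin by (simp add: ennreal_enn2real)
qed

text \<open>L2 lies in L1 on a set of finite measure, by the pointwise bound r <= 1 + r^2 in place
  of the Cauchy-Schwarz inequality.\<close>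

lemma integrable_of_energy:
  fixes f :: "'a::euclidean_space \<Rightarrow> 'b::euclidean_space"
  assumes [measurable]: "f \<in> borel_measurable borel" "S \<in> sets borel"
    and fin: "energy f < \<infinity>" "emeasure lborel S < \<infinity>" and supp: "\<And>x. x \<notin> S \<Longrightarrow> f x = 0"
  shows "integrable lborel f"
proof (rule Bochner_Integration.integrable_bound)
  have "integrable lborel (\<lambda>x. (norm (f x))\<^sup>2)"
    using fin unfolding integrable_iff_bounded energy_def by simp
  moreover have "integrable lborel (indicator S :: 'a \<Rightarrow> real)"
    using fin by simp
  ultimately show "integrable lborel (\<lambda>x. indicator S x + (norm (f x))\<^sup>2)"
    by (intro Bochner_Integration.integrable_add)
  show "AE x in lborel. norm (f x) \<le> norm (indicator S x + (norm (f x))\<^sup>2)"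
  proof (intro AE_I2)
    fix x
    have "0 \<le> (norm (f x) - 1 / 2)\<^sup>2" by simp
    then have "norm (f x) \<le> 1 + (norm (f x))\<^sup>2" by (simp add: power2_eq_square algebra_simps)
    then show "norm (f x) \<le> norm (indicator S x + (norm (f x))\<^sup>2)"
      using supp[of x] by (cases "x \<in> S") auto
  qed
qed measurable

lemma fourier_integral_diff:
  assumes "integrable lborel f" "integrable lborel g"
  shows "fourier_integral s (\<lambda>x. f x - g x) \<xi> = fourier_integral s f \<xi> - fourier_integral s g \<xi>"
  unfolding fourier_integral_def
  by (subst Bochner_Integration.integral_diff[symmetric])
     (auto intro!: integrable_fourier_integrand assms simp: left_diff_distrib)

text \<open>These are the truncations that occur in the L2 branch of
  \<open>fourier_sign\<close>.\<close>

definition ball_truncation :: "(real^'n \<Rightarrow> complex) \<Rightarrow> nat \<Rightarrow> real^'n \<Rightarrow> complex" where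
  "ball_truncation h r = zero_ext (cball 0 (real r)) h"

lemma
  fixes h :: "real^'n \<Rightarrow> complex"
  assumes [measurable]: "h \<in> borel_measurable borel" and fin: "energy h < \<infinity>"
  shows borel_measurable_ball_truncation: "ball_truncation h r \<in> borel_measurable borel"
    and integrable_ball_truncation: "integrable lborel (ball_truncation h r)"
    and energy_ball_truncation: "(\<lambda>r. energy (\<lambda>x. ball_truncation h r x - h x)) \<longlonglongrightarrow> 0"
proof -
  show m [measurable]: "ball_truncation h r \<in> borel_measurable borel" for r
    unfolding ball_truncation_def zero_ext_def
    by (intro borel_measurable_scaleR borel_measurable_indicator) (auto simp: assms)
  have "energy (ball_truncation h r) \<le> energy h"
    by (intro energy_mono_AE) (auto simp: ball_truncation_def zero_ext_def indicator_def)
  then have "energy (ball_truncation h r) < \<infinity>"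
    using fin by (rule le_less_trans)
  then show "integrable lborel (ball_truncation h r)"
    by (rule integrable_of_energy[OF m, of "cball 0 (real r)", rotated])
       (simp_all add: emeasure_bounded_finite[unfolded infinity_ennreal_def] ball_truncation_def zero_ext_def)
  have "(\<lambda>r. \<integral>\<^sup>+ x. ennreal ((norm (ball_truncation h r x - h x))\<^sup>2) \<partial>lborel) \<longlonglongrightarrow> (\<integral>\<^sup>+ (x::real^'n). 0 \<partial>lborel)"
  proof (rule nn_integral_dominated_convergence[where w = "\<lambda>x. ennreal ((norm (h x))\<^sup>2)"])
    show "AE x in lborel. (\<lambda>r. ennreal ((cmod (ball_truncation h r x - h x))\<^sup>2)) \<longlonglongrightarrow> 0"
    proof (intro AE_I2 tendsto_eventually)
      fix x :: "real^'n"
      show "\<forall>\<^sub>F r in sequentially. ennreal ((cmod (ball_truncation h r x - h x))\<^sup>2) = 0"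
        \<comment> \<open>Once r >= |x| the truncation agrees with h at x, so the sequence is
          eventually constant at every point.\<close>
        using eventually_ge_at_top[of "nat \<lceil>norm x\<rceil>"]
      proof eventually_elim
        case (elim r)
        then have "norm x \<le> real r" by linarith
        then show ?case by (simp add: ball_truncation_def zero_ext_def)
      qed
    qed
    show "AE x in lborel. ennreal ((cmod (ball_truncation h r x - h x))\<^sup>2) \<le> ennreal ((cmod (h x))\<^sup>2)" for r
      by (auto simp: ball_truncation_def zero_ext_def indicator_def intro!: AE_I2)
  qed (use fin in \<open>auto simp: energy_def\<close>)
  then show "(\<lambda>r. energy (\<lambda>x. ball_truncation h r x - h x)) \<longlonglongrightarrow> 0"
    by (simp add: energy_def)
qed

text \<open>The witness that the \<open>SOME\<close> in \<open>fourier_sign\<close> needs.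
  Truncations lie in both L1 and L2, so the Plancherel inequality makes their transforms Cauchy in
  L2, and a rapidly converging subsequence supplies the limit.\<close>

lemma ex_L2_fourier:
  fixes h :: "real^'n \<Rightarrow> complex"
  assumes h [measurable]: "h \<in> borel_measurable borel" and fin: "energy h < \<infinity>" and s: "\<bar>s\<bar> = 1"
  shows "\<exists>g. square_integrable UNIV g \<and>
    (\<lambda>r. energy (\<lambda>\<xi>. fourier_integral s (ball_truncation h r) \<xi> - g \<xi>)) \<longlonglongrightarrow> 0"
proof -
  note [measurable] = borel_measurable_ball_truncation[OF h fin]
  note int = integrable_ball_truncation[OF h fin]
  define T where "T r = energy (\<lambda>x. ball_truncation h r x - h x)" for r
  define G where "G r = fourier_integral s (ball_truncation h r)" for r
  have T0: "T \<longlonglongrightarrow> 0" unfolding T_def by (rule energy_ball_truncation[OF h fin])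
  have [measurable]: "G r \<in> borel_measurable borel" for r
    unfolding G_def by (intro borel_measurable_fourier_integral) measurable
  have GG: "energy (\<lambda>\<xi>. G q \<xi> - G r \<xi>) \<le> 2 * T q + 2 * T r" for q r
  proof -
    have "energy (\<lambda>\<xi>. G q \<xi> - G r \<xi>) = energy (fourier_integral s (\<lambda>x. ball_truncation h q x - ball_truncation h r x))"
      unfolding G_def by (intro energy_cong) (simp add: fourier_integral_diff int)
    also have "\<dots> \<le> energy (\<lambda>x. ball_truncation h q x - ball_truncation h r x)"
      by (intro energy_fourier_integral_le s Bochner_Integration.integrable_diff int)
    also have "\<dots> = energy (\<lambda>x. (ball_truncation h q x - h x) - (ball_truncation h r x - h x))"
      by (intro energy_cong) simp
    also have "\<dots> \<le> 2 * T q + 2 * T r"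
      unfolding T_def by (intro energy_diff_le) measurable
    finally show ?thesis .
  qed
  have "\<exists>r. T r \<le> ennreal ((1 / 4) ^ k)" for k
  proof -
    have "eventually (\<lambda>r. T r < ennreal ((1 / 4) ^ k)) sequentially"
      using T0 by (rule order_tendstoD) simp
    then show ?thesis by (auto dest!: eventually_happens intro: less_imp_le)
  qed
  then obtain r where r: "\<And>k. T (r k) \<le> ennreal ((1 / 4) ^ k)" by metis
  \<comment> \<open>Consecutive members differ by at most 2 * (1/4)^(k+1) + 2 * (1/4)^k <= 4 *
    (1/4)^k, so \<open>energy_complete\<close> applies with A = 4 and r = 1/4.\<close>
  have "\<exists>g\<in>borel_measurable borel. \<forall>k. energy (\<lambda>\<xi>. g \<xi> - G (r k) \<xi>) \<le> ennreal (4 * 4 * (1 / 4) ^ k)"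
  proof (rule energy_complete)
    fix k
    have "energy (\<lambda>\<xi>. G (r (Suc k)) \<xi> - G (r k) \<xi>) \<le> 2 * ennreal ((1 / 4) ^ Suc k) + 2 * ennreal ((1 / 4) ^ k)"
      by (rule order_trans[OF GG]) (intro add_mono mult_left_mono r; simp)
    also have "\<dots> = ennreal (2 * (1 / 4) ^ Suc k + 2 * (1 / 4) ^ k)"
      by (simp add: ennreal_mult ennreal_plus del: power_Suc)
    also have "\<dots> \<le> ennreal (4 * (1 / 4) ^ k)"
      by (intro ennreal_leI) simp
    finally show "energy (\<lambda>\<xi>. G (r (Suc k)) \<xi> - G (r k) \<xi>) \<le> ennreal (4 * (1 / 4) ^ k)" .
  qed (auto)
  then obtain g where g [measurable]: "g \<in> borel_measurable borel"
    and gk: "\<And>k. energy (\<lambda>\<xi>. g \<xi> - G (r k) \<xi>) \<le> ennreal (16 * (1 / 4) ^ k)"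
    by auto
  \<comment> \<open>From the subsequence to the whole sequence: compare with member
    \<open>r k\<close> and let k grow. The constant is 36 = 2 * 2 + 2 * 16.\<close>
  have bound: "energy (\<lambda>\<xi>. G q \<xi> - g \<xi>) \<le> 4 * T q" for q
  proof (rule LIMSEQ_le_const)
    have "(\<lambda>k. ennreal (36 * (1 / 4) ^ k)) \<longlonglongrightarrow> ennreal (36 * 0)"
      by (intro tendsto_intros LIMSEQ_power_zero) auto
    then show "(\<lambda>k. 4 * T q + ennreal (36 * (1 / 4) ^ k)) \<longlonglongrightarrow> 4 * T q"
      using tendsto_add[OF tendsto_const, of "\<lambda>k. ennreal (36 * (1 / 4) ^ k)" 0 sequentially "4 * T q"] by simp
    have "energy (\<lambda>\<xi>. G q \<xi> - g \<xi>) \<le> 4 * T q + ennreal (36 * (1 / 4) ^ k)" for k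
    proof -
      have "energy (\<lambda>\<xi>. G q \<xi> - g \<xi>) = energy (\<lambda>\<xi>. (G q \<xi> - G (r k) \<xi>) - (g \<xi> - G (r k) \<xi>))"
        by (intro energy_cong) simp
      also have "\<dots> \<le> 2 * energy (\<lambda>\<xi>. G q \<xi> - G (r k) \<xi>) + 2 * energy (\<lambda>\<xi>. g \<xi> - G (r k) \<xi>)"
        by (intro energy_diff_le) measurable
      also have "\<dots> \<le> 2 * (2 * T q + 2 * ennreal ((1 / 4) ^ k)) + 2 * ennreal (16 * (1 / 4) ^ k)"
        by (intro add_mono mult_left_mono gk order_trans[OF GG] r) auto
      also have "\<dots> = 4 * T q + (4 * ennreal ((1 / 4) ^ k) + 2 * ennreal (16 * (1 / 4) ^ k))"
        by (simp add: distrib_left add.assoc flip: mult.assoc)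
      also have "4 * ennreal ((1 / 4) ^ k) + 2 * ennreal (16 * (1 / 4) ^ k) = ennreal (4 * (1 / 4) ^ k + 2 * (16 * (1 / 4) ^ k))"
        by (subst ennreal_plus) (simp_all add: ennreal_mult)
      also have "4 * (1 / 4) ^ k + 2 * (16 * (1 / 4) ^ k) = (36 * (1 / 4) ^ k :: real)" by simp
      finally show ?thesis .
    qed
    then show "\<exists>N. \<forall>k\<ge>N. energy (\<lambda>\<xi>. G q \<xi> - g \<xi>) \<le> 4 * T q + ennreal (36 * (1 / 4) ^ k)" by blast
  qed
  have T4: "(\<lambda>q. 4 * T q) \<longlonglongrightarrow> 4 * 0"
    by (intro ennreal_tendsto_cmult T0) simp
  have lim: "(\<lambda>q. energy (\<lambda>\<xi>. G q \<xi> - g \<xi>)) \<longlonglongrightarrow> 0"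
    by (rule tendsto_sandwich[OF always_eventually always_eventually tendsto_const T4[unfolded mult_zero_right]])
       (simp_all add: bound)
  \<comment> \<open>Finite distance to one function of finite energy puts g itself in L2.\<close>
  have "energy g = energy (\<lambda>\<xi>. (g \<xi> - G (r 0) \<xi>) + G (r 0) \<xi>)" by simp
  also have "\<dots> \<le> 2 * energy (\<lambda>\<xi>. g \<xi> - G (r 0) \<xi>) + 2 * energy (G (r 0))"
    by (intro energy_add_le) measurable
  also have "\<dots> \<le> 2 * ennreal (16 * (1 / 4) ^ 0) + 2 * energy h"
  proof (intro add_mono mult_left_mono gk)
    have "energy (G (r 0)) \<le> energy (ball_truncation h (r 0))"
      unfolding G_def by (intro energy_fourier_integral_le s int)
    also have "\<dots> \<le> energy h"
      by (intro energy_mono_AE) (auto simp: ball_truncation_def zero_ext_def indicator_def)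
    finally show "energy (G (r 0)) \<le> energy h" .
  qed auto
  also have "\<dots> < \<infinity>" using fin by (simp add: ennreal_mult_less_top)
  finally have "square_integrable UNIV g"
    by (simp add: square_integrable_UNIV_iff)
  with lim show ?thesis unfolding G_def by blast
qed

text \<open>Both branches of \<open>fourier_sign\<close> have the same limit property on L2: in the
  integrable branch by the Plancherel inequality for the removed tail, in the other by the choice of
  \<open>SOME\<close>. Later estimates need no distinction.\<close>

lemma
  fixes h :: "real^'n \<Rightarrow> complex"
  assumes h [measurable]: "h \<in> borel_measurable borel" and fin: "energy h < \<infinity>" and s: "\<bar>s\<bar> = 1"
  shows borel_measurable_fourier_sign: "fourier_sign s h \<in> borel_measurable borel"
    and fourier_sign_limit:
      "(\<lambda>r. energy (\<lambda>\<xi>. fourier_integral s (ball_truncation h r) \<xi> - fourier_sign s h \<xi>)) \<longlonglongrightarrow> 0"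
proof -
  note int = integrable_ball_truncation[OF h fin]
  have "fourier_sign s h \<in> borel_measurable borel \<and>
    (\<lambda>r. energy (\<lambda>\<xi>. fourier_integral s (ball_truncation h r) \<xi> - fourier_sign s h \<xi>)) \<longlonglongrightarrow> 0"
  proof (cases "integrable lborel h")
    case True
    have "energy (\<lambda>\<xi>. fourier_integral s (ball_truncation h r) \<xi> - fourier_integral s h \<xi>) \<le>
        energy (\<lambda>x. ball_truncation h r x - h x)" for r
    proof -
      have "energy (\<lambda>\<xi>. fourier_integral s (ball_truncation h r) \<xi> - fourier_integral s h \<xi>) =
          energy (fourier_integral s (\<lambda>x. ball_truncation h r x - h x))"
        by (intro energy_cong) (simp add: fourier_integral_diff int True)
      also have "\<dots> \<le> energy (\<lambda>x. ball_truncation h r x - h x)"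
        by (intro energy_fourier_integral_le s Bochner_Integration.integrable_diff int True)
      finally show ?thesis .
    qed
    then have "(\<lambda>r. energy (\<lambda>\<xi>. fourier_integral s (ball_truncation h r) \<xi> - fourier_integral s h \<xi>)) \<longlonglongrightarrow> 0"
      by - (rule tendsto_sandwich[OF always_eventually always_eventually tendsto_const energy_ball_truncation[OF h fin]],
        simp_all)
    then show ?thesis
      using True by (simp add: fourier_sign_def borel_measurable_fourier_integral)
  next
    case False
    have "square_integrable UNIV (fourier_sign s h) \<and>
        (\<lambda>r. energy (\<lambda>\<xi>. fourier_integral s (ball_truncation h r) \<xi> - fourier_sign s h \<xi>)) \<longlonglongrightarrow> 0"
      using someI_ex[OF ex_L2_fourier[OF h fin s]] False
      unfolding fourier_sign_def energy_def ball_truncation_def zero_ext_def by simp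
    then show ?thesis by (simp add: square_integrable_UNIV_iff)
  qed
  then show "fourier_sign s h \<in> borel_measurable borel"
    "(\<lambda>r. energy (\<lambda>\<xi>. fourier_integral s (ball_truncation h r) \<xi> - fourier_sign s h \<xi>)) \<longlonglongrightarrow> 0"
    by auto
qed

text \<open>Stated for a difference of transforms because the chosen representatives need not be
  linear pointwise. Linearity and the Plancherel inequality are used on the truncations, and the
  approximation errors vanish in the limit. The factor 2 comes from separating these errors with
  \<open>energy_add_le\<close>.\<close>

lemma energy_fourier_sign_diff_le:
  fixes h1 h2 :: "real^'n \<Rightarrow> complex"
  assumes h1 [measurable]: "h1 \<in> borel_measurable borel" and fin1: "energy h1 < \<infinity>"
    and h2 [measurable]: "h2 \<in> borel_measurable borel" and fin2: "energy h2 < \<infinity>"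
    and s: "\<bar>s\<bar> = 1"
  shows "energy (\<lambda>\<xi>. fourier_sign s h1 \<xi> - fourier_sign s h2 \<xi>) \<le> 2 * energy (\<lambda>x. h1 x - h2 x)"
proof (rule LIMSEQ_le_const)
  note [measurable] = borel_measurable_fourier_sign[OF h1 fin1 s] borel_measurable_fourier_sign[OF h2 fin2 s]
    borel_measurable_ball_truncation[OF h1 fin1] borel_measurable_ball_truncation[OF h2 fin2]
  note int = integrable_ball_truncation[OF h1 fin1] integrable_ball_truncation[OF h2 fin2]
  let ?G1 = "\<lambda>r. fourier_integral s (ball_truncation h1 r)" and ?G2 = "\<lambda>r. fourier_integral s (ball_truncation h2 r)"
  let ?A = "\<lambda>r. energy (\<lambda>\<xi>. ?G1 r \<xi> - fourier_sign s h1 \<xi>)" and ?B = "\<lambda>r. energy (\<lambda>\<xi>. ?G2 r \<xi> - fourier_sign s h2 \<xi>)"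
  let ?D = "energy (\<lambda>x. h1 x - h2 x)"
  have [measurable]: "?G1 r \<in> borel_measurable borel" "?G2 r \<in> borel_measurable borel" for r
    by (intro borel_measurable_fourier_integral; measurable)+
  have "(\<lambda>r. 4 * ?B r + 4 * ?A r + 2 * ?D) \<longlonglongrightarrow> 4 * 0 + 4 * 0 + 2 * ?D"
    by (intro tendsto_add tendsto_const ennreal_tendsto_cmult fourier_sign_limit[OF h1 fin1 s] fourier_sign_limit[OF h2 fin2 s]) auto
  then show "(\<lambda>r. 4 * ?B r + 4 * ?A r + 2 * ?D) \<longlonglongrightarrow> 2 * ?D" by simp
  have "energy (\<lambda>\<xi>. fourier_sign s h1 \<xi> - fourier_sign s h2 \<xi>) \<le> 4 * ?B r + 4 * ?A r + 2 * ?D" for r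
  proof -
    have "energy (\<lambda>\<xi>. fourier_sign s h1 \<xi> - fourier_sign s h2 \<xi>) =
        energy (\<lambda>\<xi>. ((?G2 r \<xi> - fourier_sign s h2 \<xi>) - (?G1 r \<xi> - fourier_sign s h1 \<xi>)) + (?G1 r \<xi> - ?G2 r \<xi>))"
      by (intro energy_cong) simp
    also have "\<dots> \<le> 2 * energy (\<lambda>\<xi>. (?G2 r \<xi> - fourier_sign s h2 \<xi>) - (?G1 r \<xi> - fourier_sign s h1 \<xi>)) +
        2 * energy (\<lambda>\<xi>. ?G1 r \<xi> - ?G2 r \<xi>)"
      by (intro energy_add_le) measurable
    also have "\<dots> \<le> 2 * (2 * ?B r + 2 * ?A r) + 2 * ?D"
    proof (intro add_mono mult_left_mono)
      show "energy (\<lambda>\<xi>. (?G2 r \<xi> - fourier_sign s h2 \<xi>) - (?G1 r \<xi> - fourier_sign s h1 \<xi>)) \<le> 2 * ?B r + 2 * ?A r"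
        by (intro energy_diff_le) measurable
      have "energy (\<lambda>\<xi>. ?G1 r \<xi> - ?G2 r \<xi>) = energy (fourier_integral s (\<lambda>x. ball_truncation h1 r x - ball_truncation h2 r x))"
        by (intro energy_cong) (simp add: fourier_integral_diff int)
      also have "\<dots> \<le> energy (\<lambda>x. ball_truncation h1 r x - ball_truncation h2 r x)"
        by (intro energy_fourier_integral_le s Bochner_Integration.integrable_diff int)
      also have "\<dots> \<le> ?D"
        by (intro energy_mono_AE) (auto simp: ball_truncation_def zero_ext_def indicator_def)
      finally show "energy (\<lambda>\<xi>. ?G1 r \<xi> - ?G2 r \<xi>) \<le> ?D" .
    qed auto
    also have "\<dots> = 4 * ?B r + 4 * ?A r + 2 * ?D"
      by (simp add: distrib_left add.assoc flip: mult.assoc)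
    finally show ?thesis .
  qed
  then show "\<exists>N. \<forall>r\<ge>N. energy (\<lambda>\<xi>. fourier_sign s h1 \<xi> - fourier_sign s h2 \<xi>) \<le> 4 * ?B r + 4 * ?A r + 2 * ?D"
    by blast
qed


section \<open>Uniform boundedness for quadratic forms\<close>

text \<open>A gliding hump in Sokal's form: by the parallelogram law one of $q(s + y)$, $q(s - y)$ is at
  least $q(y)$, so the steps of a Cauchy sequence can be chosen to make $q$ large. Squared norms
  replace seminorms, hence the ratio $1/64$.\<close>

lemma quadratic_uniform_boundedness:
  fixes V :: "('x \<Rightarrow> 'b::real_vector) set" and p :: "('x \<Rightarrow> 'b) \<Rightarrow> real"
    and q :: "nat \<Rightarrow> ('x \<Rightarrow> 'b) \<Rightarrow> real"
  assumes zero: "(\<lambda>x. 0) \<in> V"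
    and add: "\<And>u v. u \<in> V \<Longrightarrow> v \<in> V \<Longrightarrow> (\<lambda>x. u x + v x) \<in> V"
    and scale: "\<And>c v. v \<in> V \<Longrightarrow> (\<lambda>x. c *\<^sub>R v x) \<in> V"
    and p_nonneg: "\<And>v. v \<in> V \<Longrightarrow> 0 \<le> p v"
    and p_scale: "\<And>c v. v \<in> V \<Longrightarrow> p (\<lambda>x. c *\<^sub>R v x) = c\<^sup>2 * p v"
    and q_nonneg: "\<And>m v. v \<in> V \<Longrightarrow> 0 \<le> q m v"
    and q_scale: "\<And>m c v. v \<in> V \<Longrightarrow> q m (\<lambda>x. c *\<^sub>R v x) = c\<^sup>2 * q m v"
    and parallelogram: "\<And>m u v. u \<in> V \<Longrightarrow> v \<in> V \<Longrightarrow>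
      q m (\<lambda>x. u x + v x) + q m (\<lambda>x. u x - v x) = 2 * q m u + 2 * q m v"
    and bounded: "\<And>m. \<exists>C. \<forall>v\<in>V. q m v \<le> C * p v"
    and pointwise: "\<And>v. v \<in> V \<Longrightarrow> \<exists>B. \<forall>m. q m v \<le> B"
    and complete: "\<And>s. (\<And>k. s k \<in> V) \<Longrightarrow> (\<And>k. p (\<lambda>x. s (Suc k) x - s k x) \<le> (1 / 64) ^ k) \<Longrightarrow>
      \<exists>u\<in>V. \<forall>k. p (\<lambda>x. u x - s k x) \<le> 4 * (1 / 64) ^ k"
  shows "\<exists>K\<ge>0. \<forall>m. \<forall>v\<in>V. q m v \<le> K * p v"
proof (rule ccontr)
  assume contra: "\<not> ?thesis"
  have diff: "(\<lambda>x. u x - v x) \<in> V" if "u \<in> V" "v \<in> V" for u v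
    using add[OF that(1) scale[OF that(2), of "- 1"]] by simp
  \<comment> \<open>The supremum \<open>a m\<close> of this set is the best constant for
    \<open>q m\<close>, a squared operator norm. The negated claim says that these constants are
    unbounded.\<close>
  define S where "S m = q m ` {v \<in> V. p v \<le> 1}" for m
  define a where "a m = Sup (S m)" for m
  have bdd: "bdd_above (S m)" for m
  proof -
    obtain C where C: "\<And>v. v \<in> V \<Longrightarrow> q m v \<le> C * p v" using bounded by blast
    have "q m v \<le> \<bar>C\<bar>" if "v \<in> V" "p v \<le> 1" for v
    proof -
      have "C * p v \<le> \<bar>C\<bar> * 1"
        using that p_nonneg by (intro mult_mono) auto
      then show ?thesis using C[OF that(1)] by simp
    qed
    then show ?thesis unfolding S_def by (auto intro!: bdd_aboveI[of _ "\<bar>C\<bar>"])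
  qed
  have "p (\<lambda>x. 0) = 0" using p_scale[OF zero, of 0] by simp
  then have S0: "q m (\<lambda>x. 0) \<in> S m" for m
    using zero unfolding S_def by auto
  have a_upper: "q m v \<le> a m" if "v \<in> V" "p v \<le> 1" for m v
    unfolding a_def using that by (intro cSup_upper bdd) (auto simp: S_def)
  have a_nonneg: "0 \<le> a m" for m
    unfolding a_def using q_nonneg[OF zero] by (intro cSup_upper2[OF S0] bdd)
  have a_bound: "q m v \<le> a m * p v" if v: "v \<in> V" for m v
  \<comment> \<open>Where p vanishes v cannot be normalized, but there \<open>bounded\<close>
    already forces q m v <= 0.\<close>
  proof (cases "p v = 0")
    case True
    then show ?thesis using bounded[of m] v by force
  next
    case False
    then have pos: "0 < p v" using p_nonneg[OF v] by simp
    let ?c = "1 / sqrt (p v)"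
    have c: "?c\<^sup>2 = 1 / p v" using pos by (simp add: power_divide)
    have "q m (\<lambda>x. ?c *\<^sub>R v x) \<le> a m"
      using pos by (intro a_upper scale v) (simp add: p_scale[OF v] c)
    then show ?thesis using pos by (simp add: q_scale[OF v] c field_simps)
  qed
  have a_unbounded: "\<exists>m. K < a m" for K
  proof (rule ccontr)
    assume "\<not> (\<exists>m. K < a m)"
    then have K: "a m \<le> K" for m by (meson not_less)
    have "q m v \<le> K * p v" if "v \<in> V" for m v
      using a_bound[OF that] mult_right_mono[OF K p_nonneg[OF that]] order_trans by blast
    moreover have "0 \<le> K" using a_nonneg K order_trans by blast
    ultimately show False using contra by blast
  qed
  \<comment> \<open>The factor 64^k pays for the later scaling by 8^(-k), which multiplies q by
    64^(-k). The factor k + 1 is the growth that survives.\<close>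
  then have "\<forall>k. \<exists>m. 64 ^ k * (real k + 1) < a m" by blast
  then obtain m where m: "\<And>k. 64 ^ k * (real k + 1) < a (m k)" by metis
  have "\<exists>v\<in>V. p v \<le> 1 \<and> a (m k) / 2 < q (m k) v" for k
  proof -
    have "(0::real) < 64 ^ k * (real k + 1)" by simp
    then have "a (m k) / 2 < a (m k)" using m[of k] by linarith
    then obtain z where "z \<in> S (m k)" "a (m k) / 2 < z"
      unfolding a_def using less_cSupE[of _ "S (m k)"] S0 by blast
    then show ?thesis unfolding S_def by auto
  qed
  then obtain z where z: "\<And>k. z k \<in> V" "\<And>k. p (z k) \<le> 1" "\<And>k. a (m k) / 2 < q (m k) (z k)"
    by metis
  define y where "y k = (\<lambda>x. ((1 / 8) ^ k) *\<^sub>R z k x)" for k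
  have sq: "(((1 / 8) ^ k)\<^sup>2 :: real) = (1 / 64) ^ k" for k
    by (simp add: power_mult[symmetric] mult.commute[of k]) (simp add: power_mult power2_eq_square)
  have yV: "y k \<in> V" for k unfolding y_def by (intro scale z)
  have py: "p (y k) \<le> (1 / 64) ^ k" for k
    unfolding y_def p_scale[OF z(1)] sq using mult_left_mono[OF z(2)[of k], of "(1 / 64) ^ k"] by simp
  have qy: "(1 / 64) ^ k * (a (m k) / 2) \<le> q (m k) (y k)" for k
    unfolding y_def q_scale[OF z(1)] sq using z(3)[of k] by (intro mult_left_mono) auto
  \<comment> \<open>The partial sums of plus or minus y k. The sign at stage k is chosen so that
    \<open>q (m k)\<close> is at least as large at the new sum as at y k.\<close>
  define s where "s = rec_nat (\<lambda>x. 0) (\<lambda>k u. if q (m k) (y k) \<le> q (m k) (\<lambda>x. u x + y k x)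
      then (\<lambda>x. u x + y k x) else (\<lambda>x. u x - y k x))"
  have s_Suc: "s (Suc k) = (if q (m k) (y k) \<le> q (m k) (\<lambda>x. s k x + y k x)
      then (\<lambda>x. s k x + y k x) else (\<lambda>x. s k x - y k x))" for k
    by (simp add: s_def)
  have sV: "s k \<in> V" for k
  proof (induction k)
    case 0 show ?case by (simp add: s_def zero)
  next
    case (Suc k) then show ?case by (auto simp: s_Suc intro: add diff yV)
  qed
  have "p (\<lambda>x. s (Suc k) x - s k x) \<le> (1 / 64) ^ k" for k
    using py[of k] p_scale[OF yV, of "- 1" k] by (auto simp: s_Suc)
  then obtain u where u: "u \<in> V" "\<And>k. p (\<lambda>x. u x - s k x) \<le> 4 * (1 / 64) ^ k"
    using complete[of s, OF sV] by blast
  have qs: "q (m k) (y k) \<le> q (m k) (s (Suc k))" for k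
    using parallelogram[OF sV yV, of "m k" k k] q_nonneg[OF sV, of "m k" k] q_nonneg[OF yV, of "m k" k]
    by (auto simp: s_Suc)
  \<comment> \<open>With t = 64^(-k) * a (m k), the hump gives at least t / 2, while the tail w has
    p w <= 4 * 64^(-k-1) and so contributes at most t / 16. Since s (Suc k) = u - w, the
    parallelogram law yields t / 2 <= 2 q u + t / 8, that is q u >= 3 t / 16.\<close>
  have large: "3 / 16 * (real k + 1) \<le> q (m k) u" for k
  proof -
    let ?w = "\<lambda>x. u x - s (Suc k) x" and ?t = "(1 / 64) ^ k * a (m k)"
    have w: "?w \<in> V" by (intro diff u sV)
    have "q (m k) ?w \<le> a (m k) * p ?w" by (rule a_bound[OF w])
    also have "\<dots> \<le> a (m k) * (4 * (1 / 64) ^ Suc k)"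
      by (intro mult_left_mono u a_nonneg)
    finally have 1: "q (m k) ?w \<le> ?t / 16" by (simp add: mult_ac)
    have "q (m k) (s (Suc k)) \<le> 2 * q (m k) u + 2 * q (m k) ?w"
      using parallelogram[OF u(1) w, of "m k"] q_nonneg[OF add[OF u(1) w], of "m k"] by simp
    then have "?t / 2 \<le> 2 * q (m k) u + 2 * (?t / 16)"
      using qy[of k, unfolded times_divide_eq_right] qs[of k] 1 by linarith
    moreover have "real k + 1 \<le> ?t"
      using m[of k] by (simp add: field_simps power_divide)
    moreover have "3 / 16 * r \<le> b" if "t / 2 \<le> 2 * b + 2 * (t / 16)" "r \<le> t" for r t b :: real
      using that by linarith
    ultimately show ?thesis by blast
  qed
  obtain B where B: "\<And>m. q m u \<le> B" using pointwise[OF u(1)] by blast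
  obtain k where "16 / 3 * B < real k" using reals_Archimedean2 by blast
  with large[of k] B[of "m k"] show False by simp
qed


section \<open>Vector-valued transforms\<close>

lemma borel_measurable_vec:
  fixes f :: "'x \<Rightarrow> 'b::euclidean_space^'v"
  assumes "\<And>i. (\<lambda>x. f x $ i) \<in> borel_measurable M"
  shows "f \<in> borel_measurable M"
proof (subst borel_measurable_euclidean_space, intro ballI)
  fix b :: "'b^'v" assume "b \<in> Basis"
  then obtain i c where b: "b = axis i c" by (auto simp: Basis_vec_def)
  have "(\<lambda>x. f x $ i \<bullet> c) \<in> borel_measurable M"
    using assms[of i] by measurable
  then show "(\<lambda>x. f x \<bullet> b) \<in> borel_measurable M"
    by (simp add: b inner_axis)
qed

lemma borel_measurable_vec_nth [measurable (raw)]: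
  fixes f :: "'x \<Rightarrow> 'b::euclidean_space^'v"
  assumes "f \<in> borel_measurable M"
  shows "(\<lambda>x. f x $ i) \<in> borel_measurable M"
proof -
  have "(\<lambda>y::'b^'v. y $ i) \<in> borel_measurable borel"
    by (intro borel_measurable_continuous_onI continuous_intros)
  then show ?thesis by (rule measurable_compose[OF assms])
qed

lemma norm_vec_square: "(norm x)\<^sup>2 = (\<Sum>i\<in>UNIV. (norm (x $ i))\<^sup>2)"
  by (simp add: norm_vec_def L2_set_def sum_nonneg)

lemma energy_vec:
  fixes f :: "'a::euclidean_space \<Rightarrow> 'b::euclidean_space^'v"
  assumes [measurable]: "f \<in> borel_measurable borel"
  shows "energy f = (\<Sum>i\<in>UNIV. energy (\<lambda>x. f x $ i))"
  unfolding energy_def norm_vec_square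
  by (simp add: nn_integral_sum[symmetric] sum_ennreal)

text \<open>No sign is imposed on M: it is replaced by its absolute value, which has the same
  square.\<close>

lemma energy_le_of_norm_le:
  fixes f :: "'a::euclidean_space \<Rightarrow> 'b::euclidean_space" and g :: "'a \<Rightarrow> 'c::euclidean_space"
  assumes [measurable]: "f \<in> borel_measurable borel"
    and "AE x in lborel. norm (g x) \<le> M * norm (f x)"
  shows "energy g \<le> ennreal (M\<^sup>2) * energy f"
proof -
  have "energy g \<le> energy (\<lambda>x. M *\<^sub>R f x)"
    using assms(2) by (intro energy_mono_AE) (auto elim!: eventually_mono intro: order_trans[OF _ mult_right_mono[OF abs_ge_self norm_ge_zero]])
  then show ?thesis by (simp add: energy_scaleR)
qed

section \<open>L2(Omega) as a vector space and the transforms on it\<close>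

lemma square_integrable_add:
  fixes u v :: "real^'n \<Rightarrow> 'b::euclidean_space"
  assumes "square_integrable \<Omega> u" "square_integrable \<Omega> v"
  shows "square_integrable \<Omega> (\<lambda>x. u x + v x)"
proof -
  have eq: "zero_ext \<Omega> (\<lambda>x. u x + v x) = (\<lambda>x. zero_ext \<Omega> u x + zero_ext \<Omega> v x)"
    by (simp add: zero_ext_def scaleR_add_right)
  have [measurable]: "zero_ext \<Omega> u \<in> borel_measurable borel" "zero_ext \<Omega> v \<in> borel_measurable borel"
    using assms by (auto simp: square_integrable_iff)
  have "energy (zero_ext \<Omega> (\<lambda>x. u x + v x)) \<le> 2 * energy (zero_ext \<Omega> u) + 2 * energy (zero_ext \<Omega> v)"
    unfolding eq by (intro energy_add_le) auto
  also have "\<dots> < \<infinity>" using assms by (simp add: square_integrable_iff ennreal_mult_less_top)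
  finally show ?thesis by (simp add: square_integrable_iff eq)
qed

lemma zero_ext_scaleR: "zero_ext \<Omega> (\<lambda>x. c *\<^sub>R v x) = (\<lambda>x. c *\<^sub>R zero_ext \<Omega> v x)"
  by (simp add: zero_ext_def mult.commute)

lemma square_integrable_scaleR:
  fixes v :: "real^'n \<Rightarrow> 'b::euclidean_space"
  assumes "square_integrable \<Omega> v"
  shows "square_integrable \<Omega> (\<lambda>x. c *\<^sub>R v x)"
  using assms by (auto simp: square_integrable_iff zero_ext_scaleR energy_scaleR ennreal_mult_less_top)

lemma square_integrable_diff:
  fixes u v :: "real^'n \<Rightarrow> 'b::euclidean_space"
  assumes "square_integrable \<Omega> u" "square_integrable \<Omega> v"
  shows "square_integrable \<Omega> (\<lambda>x. u x - v x)"
  using square_integrable_add[OF assms(1) square_integrable_scaleR[OF assms(2), of "- 1"]] by simp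

lemma square_integrable_zero: "square_integrable \<Omega> (\<lambda>x. 0 :: 'b::euclidean_space)"
  by (simp add: square_integrable_iff zero_ext_def)

text \<open>A square-integrable function on the bounded set Omega is integrable, so the forward
  transform always falls into the L1 branch of \<open>fourier_sign\<close> and no choice is
  involved.\<close>

lemma
  fixes v :: "real^'n \<Rightarrow> real^'v"
  assumes \<Omega>: "open \<Omega>" "bounded \<Omega>" and v: "square_integrable \<Omega> v"
  shows integrable_component: "integrable lborel (\<lambda>x. complex_of_real (zero_ext \<Omega> v x $ i))" (is "integrable _ ?c")
    and fourier_vec_nth: "fourier_vec \<Omega> v \<xi> $ i = fourier_integral (- 1) (\<lambda>x. complex_of_real (zero_ext \<Omega> v x $ i)) \<xi>"
proof -
  have m [measurable]: "zero_ext \<Omega> v \<in> borel_measurable borel" and fin: "energy (zero_ext \<Omega> v) < \<infinity>"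
    using v by (auto simp: square_integrable_iff)
  show int: "integrable lborel ?c"
  proof (rule integrable_of_energy)
    show "\<Omega> \<in> sets borel" using \<Omega> by simp
    show "?c \<in> borel_measurable borel" by measurable
    have "energy ?c \<le> energy (zero_ext \<Omega> v)"
      by (intro energy_mono_AE AE_I2) (simp add: component_le_norm_cart)
    then show "energy ?c < \<infinity>" using fin by (rule le_less_trans)
    show "emeasure lborel \<Omega> < \<infinity>" by (rule emeasure_bounded_finite[OF \<Omega>(2)])
  qed (simp add: zero_ext_def)
  have "(\<lambda>x. complex_of_real (indicator \<Omega> x * v x $ i)) = ?c"
    by (simp add: zero_ext_def)
  then show "fourier_vec \<Omega> v \<xi> $ i = fourier_integral (- 1) ?c \<xi>"
    using int by (simp add: fourier_vec_def fourier_def fourier_sign_def)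
qed

lemma borel_measurable_fourier_vec:
  fixes v :: "real^'n \<Rightarrow> real^'v"
  assumes "open \<Omega>" "bounded \<Omega>" "square_integrable \<Omega> v"
  shows "fourier_vec \<Omega> v \<in> borel_measurable borel"
  using integrable_component[OF assms]
  by (intro borel_measurable_vec) (auto simp: fourier_vec_nth[OF assms] intro!: borel_measurable_fourier_integral)

lemma energy_fourier_vec_le:
  fixes v :: "real^'n \<Rightarrow> real^'v"
  assumes "open \<Omega>" "bounded \<Omega>" "square_integrable \<Omega> v"
  shows "energy (fourier_vec \<Omega> v) \<le> energy (zero_ext \<Omega> v)"
proof -
  have "energy (fourier_vec \<Omega> v) = (\<Sum>i\<in>UNIV. energy (fourier_integral (- 1) (\<lambda>x. complex_of_real (zero_ext \<Omega> v x $ i))))"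
    by (subst energy_vec[OF borel_measurable_fourier_vec[OF assms]]) (simp add: fourier_vec_nth[OF assms])
  also have "\<dots> \<le> (\<Sum>i\<in>UNIV. energy (\<lambda>x. complex_of_real (zero_ext \<Omega> v x $ i)))"
    by (intro sum_mono energy_fourier_integral_le integrable_component[OF assms]) simp
  also have "\<dots> = (\<Sum>i\<in>UNIV. energy (\<lambda>x. zero_ext \<Omega> v x $ i))"
    by (intro sum.cong refl energy_cong) simp
  also have "\<dots> = energy (zero_ext \<Omega> v)"
    using assms(3) by (intro energy_vec[symmetric]) (simp add: square_integrable_iff)
  finally show ?thesis .
qed

text \<open>Exact at every frequency, because the transform is an integral here. One identity serves
  for sums, differences (c = -1) and multiples (u = 0).\<close>

lemma fourier_vec_add_scaleR:
  fixes u v :: "real^'n \<Rightarrow> real^'v"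
  assumes \<Omega>: "open \<Omega>" "bounded \<Omega>" and u: "square_integrable \<Omega> u" and v: "square_integrable \<Omega> v"
  shows "fourier_vec \<Omega> (\<lambda>x. u x + c *\<^sub>R v x) \<xi> = fourier_vec \<Omega> u \<xi> + c *\<^sub>R fourier_vec \<Omega> v \<xi>"
proof -
  have eq: "zero_ext \<Omega> (\<lambda>x. u x + c *\<^sub>R v x) x $ i = zero_ext \<Omega> u x $ i + c * zero_ext \<Omega> v x $ i" for x i
    by (simp add: zero_ext_def algebra_simps)
  have w: "square_integrable \<Omega> (\<lambda>x. u x + c *\<^sub>R v x)"
    by (intro square_integrable_add square_integrable_scaleR u v)
  note iu = integrable_fourier_integrand[OF integrable_component[OF \<Omega> u], of _ "- 1" \<xi>]
  note iv = integrable_fourier_integrand[OF integrable_component[OF \<Omega> v], of _ "- 1" \<xi>]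
  show ?thesis
  proof (rule vec_eq_iff[THEN iffD2], rule allI)
    fix i
    have "fourier_vec \<Omega> (\<lambda>x. u x + c *\<^sub>R v x) \<xi> $ i =
       (LINT x|lborel. complex_of_real (zero_ext \<Omega> u x $ i) * cis (- 1 * 2 * pi * (x \<bullet> \<xi>)) +
         complex_of_real c * (complex_of_real (zero_ext \<Omega> v x $ i) * cis (- 1 * 2 * pi * (x \<bullet> \<xi>))))"
      unfolding fourier_vec_nth[OF \<Omega> w] fourier_integral_def eq by (simp add: algebra_simps)
    also have "\<dots> = fourier_vec \<Omega> u \<xi> $ i + complex_of_real c * fourier_vec \<Omega> v \<xi> $ i"
      unfolding fourier_vec_nth[OF \<Omega> u] fourier_vec_nth[OF \<Omega> v] fourier_integral_def
      by (subst Bochner_Integration.integral_add[OF iu integrable_mult_right[OF iv]]) simp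
    finally show "fourier_vec \<Omega> (\<lambda>x. u x + c *\<^sub>R v x) \<xi> $ i = (fourier_vec \<Omega> u \<xi> + c *\<^sub>R fourier_vec \<Omega> v \<xi>) $ i"
      by (simp add: scaleR_conv_of_real[where 'a = complex])
  qed
qed

lemma fourier_vec_zero: "fourier_vec \<Omega> (\<lambda>x. 0) = (\<lambda>\<xi>. 0)"
  by (simp add: fun_eq_iff vec_eq_iff fourier_vec_def fourier_def fourier_sign_def fourier_integral_def)

text \<open>The zero function is integrable, so even here \<open>SOME\<close> does not intervene.
  This makes the image of 0 under a layer computable.\<close>

lemma inverse_fourier_vec_zero: "inverse_fourier_vec (\<lambda>\<xi>. 0) = (\<lambda>x. 0)"
  by (simp add: fun_eq_iff vec_eq_iff inverse_fourier_vec_def inverse_fourier_def fourier_sign_def fourier_integral_def)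

lemma square_integrable_component:
  fixes h :: "real^'n \<Rightarrow> complex^'v"
  assumes "square_integrable UNIV h"
  shows "(\<lambda>x. h x $ i) \<in> borel_measurable borel" "energy (\<lambda>x. h x $ i) < \<infinity>"
proof -
  show "(\<lambda>x. h x $ i) \<in> borel_measurable borel"
    using assms by (auto simp: square_integrable_UNIV_iff)
  have "energy (\<lambda>x. h x $ i) \<le> energy h"
    by (intro energy_mono_AE AE_I2) (simp add: Finite_Cartesian_Product.norm_nth_le)
  then show "energy (\<lambda>x. h x $ i) < \<infinity>"
    using assms by (auto simp: square_integrable_UNIV_iff intro: le_less_trans)
qed

lemma borel_measurable_inverse_fourier_vec:
  assumes "square_integrable UNIV h"
  shows "inverse_fourier_vec h \<in> borel_measurable borel"
  using square_integrable_component[OF assms]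
  by (intro borel_measurable_vec) (auto simp: inverse_fourier_vec_def inverse_fourier_def intro!: borel_measurable_fourier_sign)

lemma energy_inverse_fourier_vec_diff_le:
  fixes h k :: "real^'n \<Rightarrow> complex^'v"
  assumes h: "square_integrable UNIV h" and k: "square_integrable UNIV k"
  shows "energy (\<lambda>x. inverse_fourier_vec h x - inverse_fourier_vec k x) \<le> 2 * energy (\<lambda>\<xi>. h \<xi> - k \<xi>)"
proof -
  note [measurable] = borel_measurable_inverse_fourier_vec[OF h] borel_measurable_inverse_fourier_vec[OF k]
  have [measurable]: "h \<in> borel_measurable borel" "k \<in> borel_measurable borel"
    using assms by (auto simp: square_integrable_UNIV_iff)
  have "energy (\<lambda>x. inverse_fourier_vec h x - inverse_fourier_vec k x) =
      (\<Sum>i\<in>UNIV. energy (\<lambda>x. fourier_sign 1 (\<lambda>\<xi>. h \<xi> $ i) x - fourier_sign 1 (\<lambda>\<xi>. k \<xi> $ i) x))"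
    by (subst energy_vec, measurable) (simp add: inverse_fourier_vec_def inverse_fourier_def)
  also have "\<dots> \<le> (\<Sum>i\<in>UNIV. 2 * energy (\<lambda>\<xi>. h \<xi> $ i - k \<xi> $ i))"
    by (intro sum_mono energy_fourier_sign_diff_le square_integrable_component h k) simp
  also have "\<dots> = 2 * energy (\<lambda>\<xi>. h \<xi> - k \<xi>)"
    by (subst energy_vec) (auto simp: sum_distrib_left)
  finally show ?thesis .
qed

section \<open>Matrices acting on vectors\<close>

lemma norm_matrix_vector_mult_le:
  fixes A :: "'b::{euclidean_space,real_normed_algebra_1}^'n^'m"
  shows "norm (A *v x) \<le> matrix_2norm A * norm x"
  unfolding matrix_2norm_def by (intro onorm matrix_vector_mul_bounded_linear)

text \<open>For truncating a multiplier the sum of the moduli of its entries is preferable to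
  \<open>matrix_2norm\<close>: its measurability in the frequency follows at once from that of the
  entries.\<close>

lemma norm_matrix_vector_mult_le_sum:
  fixes A :: "complex^'n^'m"
  shows "norm (A *v x) \<le> (\<Sum>i\<in>UNIV. \<Sum>j\<in>UNIV. cmod (A $ i $ j)) * norm x"
proof -
  have "norm (A *v x) \<le> (\<Sum>i\<in>UNIV. cmod ((A *v x) $ i))"
    unfolding norm_vec_def by (rule L2_set_le_sum) simp
  also have "\<dots> \<le> (\<Sum>i\<in>UNIV. \<Sum>j\<in>UNIV. cmod (A $ i $ j) * norm x)"
  proof (intro sum_mono)
    fix i
    have "cmod ((A *v x) $ i) \<le> (\<Sum>j\<in>UNIV. cmod (A $ i $ j * x $ j))"
      unfolding matrix_vector_mult_def by (simp add: norm_sum)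
    also have "\<dots> \<le> (\<Sum>j\<in>UNIV. cmod (A $ i $ j) * norm x)"
      by (intro sum_mono) (simp add: norm_mult mult_left_mono Finite_Cartesian_Product.norm_nth_le)
    finally show "cmod ((A *v x) $ i) \<le> (\<Sum>j\<in>UNIV. cmod (A $ i $ j) * norm x)" .
  qed
  finally show ?thesis by (simp add: sum_distrib_right)
qed

lemma matrix_vector_mult_scaleR_right:
  fixes A :: "complex^'n^'m"
  shows "A *v (c *\<^sub>R x) = c *\<^sub>R (A *v x)"
  by (simp add: vec_eq_iff matrix_vector_mult_def scaleR_sum_right)

text \<open>\<open>fno_layer_on\<close> places each kernel entry in L1 or in L2, and each
  alternative makes its transform measurable.\<close>

lemma borel_measurable_R_t:
  assumes l: "fno_layer_on \<Omega> l" and t: "0 \<le> t"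
  shows "(\<lambda>\<xi>. R_t l t \<xi> $ i $ j) \<in> borel_measurable borel"
proof -
  let ?k = "\<lambda>x. complex_of_real (kernel l x $ i $ j)"
  have "fourier ?k \<in> borel_measurable borel"
  proof (cases "integrable lborel (\<lambda>x. kernel l x $ i $ j)")
    case True
    then show ?thesis
      by (auto simp: fourier_def fourier_sign_def intro!: borel_measurable_fourier_integral)
  next
    case False
    then have sq: "square_integrable UNIV (\<lambda>x. kernel l x $ i $ j)"
      using l unfolding fno_layer_on_def by blast
    have "energy ?k = energy (\<lambda>x. kernel l x $ i $ j)"
      by (intro energy_cong) simp
    then show ?thesis
      using sq unfolding fourier_def
      by (intro borel_measurable_fourier_sign) (auto simp: square_integrable_UNIV_iff)
  qed
  then show ?thesis
    using l t by (auto simp: R_t_def fourier_mat_def fno_layer_on_def)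
qed


section \<open>Bounded multipliers\<close>

text \<open>K bounds the square of an operator norm. Only transforms of functions living on Omega
  are tested, so an R that is not essentially bounded may qualify, as is needed at t = 0.\<close>

definition bounded_multiplier :: "(real^'n) set \<Rightarrow> (real^'n \<Rightarrow> complex^'v^'v) \<Rightarrow> real \<Rightarrow> bool" where
  "bounded_multiplier \<Omega> R K \<longleftrightarrow> (\<forall>v. square_integrable \<Omega> v \<longrightarrow>
     energy (\<lambda>\<xi>. R \<xi> *v fourier_vec \<Omega> v \<xi>) \<le> ennreal K * energy (zero_ext \<Omega> v))"

lemma bounded_multiplier_of_AE:
  fixes \<Omega> :: "(real^'n) set" and R :: "real^'n \<Rightarrow> complex^'v^'v"
  assumes \<Omega>: "open \<Omega>" "bounded \<Omega>" and R: "AE \<xi> in lborel. matrix_2norm (R \<xi>) \<le> M"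
  shows "bounded_multiplier \<Omega> R (M\<^sup>2)"
  unfolding bounded_multiplier_def
proof (intro allI impI)
  fix v :: "real^'n \<Rightarrow> real^'v" assume v: "square_integrable \<Omega> v"
  have "energy (\<lambda>\<xi>. R \<xi> *v fourier_vec \<Omega> v \<xi>) \<le> ennreal (M\<^sup>2) * energy (fourier_vec \<Omega> v)"
  proof (rule energy_le_of_norm_le[OF borel_measurable_fourier_vec[OF \<Omega> v]])
    show "AE \<xi> in lborel. norm (R \<xi> *v fourier_vec \<Omega> v \<xi>) \<le> M * norm (fourier_vec \<Omega> v \<xi>)"
      using R by eventually_elim (rule order_trans[OF norm_matrix_vector_mult_le mult_right_mono], auto)
  qed
  also have "\<dots> \<le> ennreal (M\<^sup>2) * energy (zero_ext \<Omega> v)"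
    by (intro mult_left_mono energy_fourier_vec_le \<Omega> v) auto
  finally show "energy (\<lambda>\<xi>. R \<xi> *v fourier_vec \<Omega> v \<xi>) \<le> ennreal (M\<^sup>2) * energy (zero_ext \<Omega> v)" .
qed

text \<open>The limit of the zero extensions is obtained on the whole space. Restricting to Omega
  only decreases energies, so the bounds survive.\<close>

lemma square_integrable_complete:
  fixes s :: "nat \<Rightarrow> real^'n \<Rightarrow> 'b::euclidean_space"
  assumes s: "\<And>k. square_integrable \<Omega> (s k)"
    and step: "\<And>k. energy (zero_ext \<Omega> (\<lambda>x. s (Suc k) x - s k x)) \<le> ennreal (A * r ^ k)"
    and \<Omega>: "open \<Omega>" and r: "0 \<le> r" "r \<le> 1 / 4" and A: "0 \<le> A"
  shows "\<exists>u. square_integrable \<Omega> u \<and> (\<forall>k. energy (zero_ext \<Omega> (\<lambda>x. u x - s k x)) \<le> ennreal (4 * A * r ^ k))"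
proof -
  have m [measurable]: "zero_ext \<Omega> (s k) \<in> borel_measurable borel" for k
    using s by (simp add: square_integrable_iff)
  obtain g where g [measurable]: "g \<in> borel_measurable borel"
    and gk: "\<And>k. energy (\<lambda>x. g x - zero_ext \<Omega> (s k) x) \<le> ennreal (4 * A * r ^ k)"
    using energy_complete[of "\<lambda>k. zero_ext \<Omega> (s k)", OF m step[unfolded zero_ext_diff] r A] by blast
  have le: "energy (zero_ext \<Omega> (\<lambda>x. g x - s k x)) \<le> ennreal (4 * A * r ^ k)" for k
    by (rule order_trans[OF energy_mono_AE gk]) (auto simp: zero_ext_def indicator_def intro!: AE_I2)
  have meas: "zero_ext \<Omega> g \<in> borel_measurable borel"
    unfolding zero_ext_def using \<Omega> g by (intro borel_measurable_scaleR borel_measurable_indicator) auto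
  then have "zero_ext \<Omega> (\<lambda>x. g x - s 0 x) \<in> borel_measurable borel"
    unfolding zero_ext_diff by (intro borel_measurable_diff m)
  moreover have "energy (zero_ext \<Omega> (\<lambda>x. g x - s 0 x)) < \<infinity>"
    using le[of 0] by (rule le_less_trans) simp
  ultimately have "square_integrable \<Omega> (\<lambda>x. g x - s 0 x)"
    by (simp add: square_integrable_iff)
  from square_integrable_add[OF this s[of 0]] have "square_integrable \<Omega> g" by simp
  with le show ?thesis by blast
qed

text \<open>In the spirit of the closed graph theorem: an operator defined on all of L2(Omega) is
  bounded. For each v the energy of the full image dominates those of all truncated images, which is
  the pointwise boundedness of the principle. Fatou's lemma then carries the common constant over to
  R.\<close>

lemma bounded_multiplier_of_square_integrable:
  fixes \<Omega> :: "(real^'n) set" and R :: "real^'n \<Rightarrow> complex^'v^'v"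
  assumes \<Omega>: "open \<Omega>" "bounded \<Omega>"
    and meas: "\<And>i j. (\<lambda>\<xi>. R \<xi> $ i $ j) \<in> borel_measurable borel"
    and R: "\<And>v. square_integrable \<Omega> v \<Longrightarrow> square_integrable UNIV (\<lambda>\<xi>. R \<xi> *v fourier_vec \<Omega> v \<xi>)"
  shows "\<exists>K\<ge>0. bounded_multiplier \<Omega> R K"
proof -
  note [measurable] = meas
  define a where "a \<xi> = (\<Sum>i\<in>UNIV. \<Sum>j\<in>UNIV. cmod (R \<xi> $ i $ j))" for \<xi>
  have a_meas [measurable]: "a \<in> borel_measurable borel" unfolding a_def[abs_def] by measurable
  \<comment> \<open>Cutting off in frequency, rather than capping the values, keeps the truncated
    operator linear in v.\<close>
  define T where "T m v \<xi> = indicator {\<xi>. a \<xi> \<le> real m} \<xi> *\<^sub>R (R \<xi> *v fourier_vec \<Omega> v \<xi>)" for m :: nat and v \<xi>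
  \<comment> \<open>The principle speaks of real-valued forms. All energies involved are finite on
    L2(Omega), so \<open>enn2real\<close> loses nothing there.\<close>
  define p where "p v = enn2real (energy (zero_ext \<Omega> v))" for v :: "real^'n \<Rightarrow> real^'v"
  define q where "q m v = enn2real (energy (T m v))" for m v
  have p_nonneg: "0 \<le> p v" and q_nonneg: "0 \<le> q m v" for m v
    by (simp_all add: p_def q_def)
  have p_eq: "ennreal (p v) = energy (zero_ext \<Omega> v)" if "square_integrable \<Omega> v" for v
    using that by (simp add: p_def square_integrable_iff)
  have RF_meas: "(\<lambda>\<xi>. R \<xi> *v fourier_vec \<Omega> v \<xi>) \<in> borel_measurable borel"
    and RF_fin: "energy (\<lambda>\<xi>. R \<xi> *v fourier_vec \<Omega> v \<xi>) < \<infinity>" if "square_integrable \<Omega> v" for v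
    using R[OF that] by (auto simp: square_integrable_UNIV_iff)
  have T_meas: "T m v \<in> borel_measurable borel" if v: "square_integrable \<Omega> v" for m v
    unfolding T_def[abs_def] using RF_meas[OF v] by measurable
  have T_le: "energy (T m v) \<le> energy (\<lambda>\<xi>. R \<xi> *v fourier_vec \<Omega> v \<xi>)" for m v
    by (intro energy_mono_AE) (auto simp: T_def indicator_def)
  have q_eq: "ennreal (q m v) = energy (T m v)" if "square_integrable \<Omega> v" for m v
    using le_less_trans[OF T_le RF_fin[OF that]] by (simp add: q_def)
  have T_lin: "T m (\<lambda>x. u x + c *\<^sub>R v x) \<xi> = T m u \<xi> + c *\<^sub>R T m v \<xi>"
    if "square_integrable \<Omega> u" "square_integrable \<Omega> v" for m u v c \<xi>
    unfolding T_def fourier_vec_add_scaleR[OF \<Omega> that]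
    by (simp add: matrix_vector_right_distrib matrix_vector_mult_scaleR_right scaleR_add_right mult.commute)
  have T_scale: "T m (\<lambda>x. c *\<^sub>R v x) \<xi> = c *\<^sub>R T m v \<xi>" if "square_integrable \<Omega> v" for m v c \<xi>
    using T_lin[OF square_integrable_zero that, of m c \<xi>] by (simp add: T_def fourier_vec_zero)
  have "\<exists>K\<ge>0. \<forall>m. \<forall>v\<in>{v. square_integrable \<Omega> v}. q m v \<le> K * p v"
  proof (rule quadratic_uniform_boundedness, unfold mem_Collect_eq)
    fix u v :: "real^'n \<Rightarrow> real^'v" and c :: real and m :: nat
    assume v: "square_integrable \<Omega> v"
    show "p (\<lambda>x. c *\<^sub>R v x) = c\<^sup>2 * p v"
      using v by (simp add: p_def zero_ext_scaleR energy_scaleR square_integrable_iff enn2real_mult)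
    have "T m (\<lambda>x. c *\<^sub>R v x) = (\<lambda>\<xi>. c *\<^sub>R T m v \<xi>)" using T_scale[OF v] by auto
    then show "q m (\<lambda>x. c *\<^sub>R v x) = c\<^sup>2 * q m v"
      by (simp add: q_def energy_scaleR T_meas[OF v] enn2real_mult)
    show "\<exists>B. \<forall>m. q m v \<le> B"
      unfolding q_def using RF_fin[OF v]
      by (intro exI[of _ "enn2real (energy (\<lambda>\<xi>. R \<xi> *v fourier_vec \<Omega> v \<xi>))"] allI enn2real_mono[OF T_le]) simp
    assume u: "square_integrable \<Omega> u"
    have "T m (\<lambda>x. u x + v x) = (\<lambda>\<xi>. T m u \<xi> + T m v \<xi>)" "T m (\<lambda>x. u x - v x) = (\<lambda>\<xi>. T m u \<xi> - T m v \<xi>)"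
      using T_lin[OF u v, of m 1] T_lin[OF u v, of m "- 1"] by auto
    then have "energy (T m (\<lambda>x. u x + v x)) + energy (T m (\<lambda>x. u x - v x)) = 2 * energy (T m u) + 2 * energy (T m v)"
      by (simp add: energy_parallelogram T_meas u v)
    then have "ennreal (q m (\<lambda>x. u x + v x) + q m (\<lambda>x. u x - v x)) = ennreal (2 * q m u + 2 * q m v)"
      by (simp add: ennreal_plus ennreal_mult q_eq u v square_integrable_add square_integrable_diff q_nonneg)
    then show "q m (\<lambda>x. u x + v x) + q m (\<lambda>x. u x - v x) = 2 * q m u + 2 * q m v"
      by (subst (asm) ennreal_inj) (auto simp: q_nonneg)
  next
    fix m :: nat
    have "q m v \<le> (real m)\<^sup>2 * p v" if v: "square_integrable \<Omega> v" for v
    proof -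
      have "energy (T m v) \<le> ennreal ((real m)\<^sup>2) * energy (fourier_vec \<Omega> v)"
      proof (intro energy_le_of_norm_le borel_measurable_fourier_vec[OF \<Omega> v] AE_I2)
        fix \<xi>
        have "norm (R \<xi> *v fourier_vec \<Omega> v \<xi>) \<le> real m * norm (fourier_vec \<Omega> v \<xi>)" if "a \<xi> \<le> real m"
          using norm_matrix_vector_mult_le_sum[of "R \<xi>" "fourier_vec \<Omega> v \<xi>"] mult_right_mono[OF that norm_ge_zero]
          unfolding a_def by (rule order_trans)
        then show "norm (T m v \<xi>) \<le> real m * norm (fourier_vec \<Omega> v \<xi>)"
          by (auto simp: T_def indicator_def)
      qed
      also have "\<dots> \<le> ennreal ((real m)\<^sup>2) * energy (zero_ext \<Omega> v)"
        by (intro mult_left_mono energy_fourier_vec_le \<Omega> v) auto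
      finally have "ennreal (q m v) \<le> ennreal ((real m)\<^sup>2 * p v)"
        by (simp add: q_eq[OF v] p_eq[OF v] ennreal_mult p_nonneg)
      then show ?thesis by (subst (asm) ennreal_le_iff) (auto simp: p_nonneg)
    qed
    then show "\<exists>C. \<forall>v\<in>{v. square_integrable \<Omega> v}. q m v \<le> C * p v" by blast
  next
    fix s :: "nat \<Rightarrow> real^'n \<Rightarrow> real^'v"
    assume s: "\<And>k. square_integrable \<Omega> (s k)"
      and step: "\<And>k. p (\<lambda>x. s (Suc k) x - s k x) \<le> (1 / 64) ^ k"
    \<comment> \<open>With A = 1 and r = 1/64 completeness of L2(Omega) yields the bound 4 *
      (1/64)^k that the principle asks for.\<close>
    have "energy (zero_ext \<Omega> (\<lambda>x. s (Suc k) x - s k x)) \<le> ennreal (1 * (1 / 64) ^ k)" for k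
      using step[of k] by (subst p_eq[symmetric]) (auto intro!: square_integrable_diff s ennreal_leI)
    from square_integrable_complete[OF s this \<Omega>(1)]
    obtain u where u: "square_integrable \<Omega> u"
      and le: "\<And>k. energy (zero_ext \<Omega> (\<lambda>x. u x - s k x)) \<le> ennreal (4 * 1 * (1 / 64) ^ k)"
      by auto
    have "p (\<lambda>x. u x - s k x) \<le> 4 * (1 / 64) ^ k" for k
      unfolding p_def using le[of k] by (intro enn2real_leI) auto
    with u show "\<exists>u\<in>{v. square_integrable \<Omega> v}. \<forall>k. p (\<lambda>x. u x - s k x) \<le> 4 * (1 / 64) ^ k" by auto
  qed (auto simp: square_integrable_zero square_integrable_add square_integrable_scaleR p_nonneg q_nonneg)
  then obtain K where K: "0 \<le> K" "\<And>m v. square_integrable \<Omega> v \<Longrightarrow> q m v \<le> K * p v" by auto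
  have "bounded_multiplier \<Omega> R K"
    unfolding bounded_multiplier_def
  proof (intro allI impI)
    fix v :: "real^'n \<Rightarrow> real^'v" assume v: "square_integrable \<Omega> v"
    note [measurable] = T_meas[OF v]
    \<comment> \<open>At each frequency the truncation is eventually inactive, so the integrand is
      its own limit inferior.\<close>
    have "energy (\<lambda>\<xi>. R \<xi> *v fourier_vec \<Omega> v \<xi>) = (\<integral>\<^sup>+ \<xi>. liminf (\<lambda>m. ennreal ((norm (T m v \<xi>))\<^sup>2)) \<partial>lborel)"
      unfolding energy_def
    proof (intro nn_integral_cong)
      fix \<xi>
      have "\<forall>\<^sub>F m in sequentially. ennreal ((norm (T m v \<xi>))\<^sup>2) = ennreal ((norm (R \<xi> *v fourier_vec \<Omega> v \<xi>))\<^sup>2)"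
        using eventually_ge_at_top[of "nat \<lceil>a \<xi>\<rceil>"]
      proof eventually_elim
        case (elim m)
        then have "a \<xi> \<le> real m" by linarith
        then show ?case by (simp add: T_def)
      qed
      then show "ennreal ((norm (R \<xi> *v fourier_vec \<Omega> v \<xi>))\<^sup>2) = liminf (\<lambda>m. ennreal ((norm (T m v \<xi>))\<^sup>2))"
        by (intro lim_imp_Liminf[OF sequentially_bot, symmetric] tendsto_eventually)
    qed
    also have "\<dots> \<le> liminf (\<lambda>m. energy (T m v))"
      unfolding energy_def by (intro nn_integral_liminf) measurable
    also have "\<dots> \<le> liminf (\<lambda>m::nat. ennreal (K * p v))"
      using K(2)[OF v] by (intro Liminf_mono always_eventually allI) (simp add: q_eq[OF v, symmetric] ennreal_leI)
    also have "\<dots> = ennreal K * energy (zero_ext \<Omega> v)"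
      using K(1) by (simp add: Liminf_const ennreal_mult p_eq[OF v] p_nonneg)
    finally show "energy (\<lambda>\<xi>. R \<xi> *v fourier_vec \<Omega> v \<xi>) \<le> ennreal K * energy (zero_ext \<Omega> v)" .
  qed
  with K(1) show ?thesis by blast
qed


section \<open>Lipschitz maps on L2\<close>

text \<open>L is the square of a Lipschitz constant and is chosen before t. Preservation of L2 is
  included so that such maps compose.\<close>

definition L2_lipschitz :: "(real^'n) set \<Rightarrow> (real \<Rightarrow> (real^'n \<Rightarrow> real^'a) \<Rightarrow> real^'n \<Rightarrow> real^'b) \<Rightarrow> bool" where
  "L2_lipschitz \<Omega> T \<longleftrightarrow> (\<exists>L\<ge>0. \<forall>t\<ge>0. \<forall>u v. square_integrable \<Omega> u \<longrightarrow> square_integrable \<Omega> v \<longrightarrow>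
     square_integrable \<Omega> (T t u) \<and>
     energy (zero_ext \<Omega> (\<lambda>x. T t u x - T t v x)) \<le> ennreal L * energy (zero_ext \<Omega> (\<lambda>x. u x - v x)))"

lemma L2_lipschitz_id: "L2_lipschitz \<Omega> (\<lambda>t u. u)"
  unfolding L2_lipschitz_def by (intro exI[of _ 1]) simp

lemma L2_lipschitz_compose:
  fixes S :: "real \<Rightarrow> (real^'n \<Rightarrow> real^'a) \<Rightarrow> real^'n \<Rightarrow> real^'b"
    and T :: "real \<Rightarrow> (real^'n \<Rightarrow> real^'b) \<Rightarrow> real^'n \<Rightarrow> real^'c"
  assumes S: "L2_lipschitz \<Omega> S" and T: "L2_lipschitz \<Omega> T"
  shows "L2_lipschitz \<Omega> (\<lambda>t u. T t (S t u))"
proof -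
  obtain K where K: "0 \<le> K" "\<And>t u v. 0 \<le> t \<Longrightarrow> square_integrable \<Omega> u \<Longrightarrow> square_integrable \<Omega> v \<Longrightarrow>
     square_integrable \<Omega> (S t u) \<and>
     energy (zero_ext \<Omega> (\<lambda>x. S t u x - S t v x)) \<le> ennreal K * energy (zero_ext \<Omega> (\<lambda>x. u x - v x))"
    using S unfolding L2_lipschitz_def by blast
  obtain L where L: "0 \<le> L" "\<And>t u v. 0 \<le> t \<Longrightarrow> square_integrable \<Omega> u \<Longrightarrow> square_integrable \<Omega> v \<Longrightarrow>
     square_integrable \<Omega> (T t u) \<and>
     energy (zero_ext \<Omega> (\<lambda>x. T t u x - T t v x)) \<le> ennreal L * energy (zero_ext \<Omega> (\<lambda>x. u x - v x))"
    using T unfolding L2_lipschitz_def by blast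
  show ?thesis
    unfolding L2_lipschitz_def
  proof (intro exI[of _ "L * K"] conjI allI impI)
    show "0 \<le> L * K" using K(1) L(1) by simp
    fix t :: real and u v :: "real^'n \<Rightarrow> real^'a"
    assume t: "0 \<le> t" and u: "square_integrable \<Omega> u" and v: "square_integrable \<Omega> v"
    have Su: "square_integrable \<Omega> (S t u)" and Sv: "square_integrable \<Omega> (S t v)"
      using K(2)[OF t u v] K(2)[OF t v u] by auto
    show "square_integrable \<Omega> (T t (S t u))" using L(2)[OF t Su Sv] by simp
    have "energy (zero_ext \<Omega> (\<lambda>x. T t (S t u) x - T t (S t v) x)) \<le>
        ennreal L * energy (zero_ext \<Omega> (\<lambda>x. S t u x - S t v x))"
      using L(2)[OF t Su Sv] by simp
    also have "\<dots> \<le> ennreal L * (ennreal K * energy (zero_ext \<Omega> (\<lambda>x. u x - v x)))"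
      using K(2)[OF t u v] by (intro mult_left_mono) auto
    finally show "energy (zero_ext \<Omega> (\<lambda>x. T t (S t u) x - T t (S t v) x)) \<le>
        ennreal (L * K) * energy (zero_ext \<Omega> (\<lambda>x. u x - v x))"
      using K(1) L(1) by (simp add: ennreal_mult mult.assoc)
  qed
qed

lemma L2_lipschitz_fold:
  assumes "\<And>l. l \<in> set ls \<Longrightarrow> L2_lipschitz \<Omega> (T l)"
  shows "L2_lipschitz \<Omega> (\<lambda>t u. fold (\<lambda>l. T l t) ls u)"
  using assms
proof (induction ls)
  case Nil
  then show ?case by (simp add: L2_lipschitz_id)
next
  case (Cons l ls)
  then have "L2_lipschitz \<Omega> (T l)" "L2_lipschitz \<Omega> (\<lambda>t. fold (\<lambda>l. T l t) ls)" by simp_all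
  from L2_lipschitz_compose[OF this] show ?case by simp
qed

section \<open>Constant matrices\<close>

lemma zero_ext_matrix_vector_mult: "zero_ext \<Omega> (\<lambda>x. A *v u x) = (\<lambda>x. A *v zero_ext \<Omega> u x)" for A :: "real^'a^'b"
  by (simp add: zero_ext_def matrix_vector_mult_scaleR)

lemma borel_measurable_matrix_vector_mult:
  fixes A :: "real^'a^'b"
  assumes "f \<in> borel_measurable M"
  shows "(\<lambda>x. A *v f x) \<in> borel_measurable M"
  by (intro measurable_compose[OF assms] borel_measurable_continuous_onI linear_continuous_on) simp

lemma energy_matrix_vector_mult_le:
  fixes A :: "real^'a^'b" and u :: "real^'n \<Rightarrow> real^'a"
  assumes u: "square_integrable \<Omega> u" and A: "matrix_2norm A \<le> M"
  shows "energy (zero_ext \<Omega> (\<lambda>x. A *v u x)) \<le> ennreal (M\<^sup>2) * energy (zero_ext \<Omega> u)"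
  unfolding zero_ext_matrix_vector_mult
proof (intro energy_le_of_norm_le AE_I2)
  show "norm (A *v zero_ext \<Omega> u x) \<le> M * norm (zero_ext \<Omega> u x)" for x
    using A by (intro order_trans[OF norm_matrix_vector_mult_le mult_right_mono]) auto
qed (use u in \<open>simp add: square_integrable_iff\<close>)

lemma square_integrable_matrix_vector_mult:
  fixes A :: "real^'a^'b" and u :: "real^'n \<Rightarrow> real^'a"
  assumes u: "square_integrable \<Omega> u"
  shows "square_integrable \<Omega> (\<lambda>x. A *v u x)"
proof -
  have "energy (zero_ext \<Omega> (\<lambda>x. A *v u x)) < \<infinity>"
    using u by (intro le_less_trans[OF energy_matrix_vector_mult_le[OF u order_refl]])
      (simp add: square_integrable_iff ennreal_mult_less_top)
  then show ?thesis
    using u by (simp add: square_integrable_iff zero_ext_matrix_vector_mult borel_measurable_matrix_vector_mult)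
qed

lemma L2_lipschitz_matrix:
  fixes A :: "real^'a^'b" and \<Omega> :: "(real^'n) set"
  shows "L2_lipschitz \<Omega> (\<lambda>t u x. A *v u x)"
  unfolding L2_lipschitz_def
  using energy_matrix_vector_mult_le[OF square_integrable_diff order_refl, of \<Omega> _ _ A]
  by (intro exI[of _ "(matrix_2norm A)\<^sup>2"]) (simp add: square_integrable_matrix_vector_mult matrix_vector_mult_diff_distrib)

lemma L2_stable_of_L2_lipschitz:
  fixes S :: "real \<Rightarrow> (real^'n \<Rightarrow> real^'a) \<Rightarrow> real^'n \<Rightarrow> real^'b"
  assumes "L2_lipschitz \<Omega> S"
  shows "L2_stable \<Omega> S"
  unfolding L2_stable_def
proof (intro allI impI)
  fix u :: "real^'n \<Rightarrow> real^'a" and \<epsilon> :: real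
  assume u: "square_integrable \<Omega> u" and \<epsilon>: "0 < \<epsilon>"
  obtain L where L: "0 \<le> L" "\<And>t u v. 0 \<le> t \<Longrightarrow> square_integrable \<Omega> u \<Longrightarrow> square_integrable \<Omega> v \<Longrightarrow>
     square_integrable \<Omega> (S t u) \<and>
     energy (zero_ext \<Omega> (\<lambda>x. S t u x - S t v x)) \<le> ennreal L * energy (zero_ext \<Omega> (\<lambda>x. u x - v x))"
    using assms unfolding L2_lipschitz_def by blast
  \<comment> \<open>L + 1 instead of L avoids division by zero when L = 0 and makes the final
    inequality strict: L * delta^2 < (L + 1) * delta^2 = epsilon^2.\<close>
  define \<delta> where "\<delta> = \<epsilon> / sqrt (L + 1)"
  have \<delta>: "0 < \<delta>" using \<epsilon> L(1) by (simp add: \<delta>_def)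
  have "square_integrable \<Omega> (\<lambda>x. S t v x - S t u x) \<and> L2_norm \<Omega> (\<lambda>x. S t v x - S t u x) < \<epsilon>"
    if v: "square_integrable \<Omega> v" and near: "L2_norm \<Omega> (\<lambda>x. v x - u x) < \<delta>" and t: "0 \<le> t" for v :: "real^'n \<Rightarrow> real^'a" and t
  proof
    show sq: "square_integrable \<Omega> (\<lambda>x. S t v x - S t u x)"
      using L(2)[OF t u v] L(2)[OF t v u] by (intro square_integrable_diff) auto
    have "ennreal ((L2_norm \<Omega> (\<lambda>x. S t v x - S t u x))\<^sup>2) \<le> ennreal (L * (L2_norm \<Omega> (\<lambda>x. v x - u x))\<^sup>2)"
      using L(2)[OF t v u] L(1) by (simp add: ennreal_mult L2_norm_eq sq square_integrable_diff[OF v u])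
    then have "(L2_norm \<Omega> (\<lambda>x. S t v x - S t u x))\<^sup>2 \<le> L * (L2_norm \<Omega> (\<lambda>x. v x - u x))\<^sup>2"
      using L(1) by (subst (asm) ennreal_le_iff) auto
    also have "\<dots> \<le> L * \<delta>\<^sup>2"
      using near L(1) by (intro mult_left_mono power_mono)
        (auto simp: L2_norm_def set_lebesgue_integral_def intro!: integral_nonneg_AE)
    also have "\<dots> < (L + 1) * \<delta>\<^sup>2" using \<delta> by simp
    also have "\<dots> = \<epsilon>\<^sup>2" using L(1) by (simp add: \<delta>_def power_divide)
    finally show "L2_norm \<Omega> (\<lambda>x. S t v x - S t u x) < \<epsilon>"
      by (rule power2_less_imp_less) (use \<epsilon> in simp)
  qed
  with \<delta> show "\<exists>\<delta>>0. \<forall>u0'. square_integrable \<Omega> u0' \<and> L2_norm \<Omega> (\<lambda>x. u0' x - u x) < \<delta> \<longrightarrow>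
      (\<forall>t\<ge>0. square_integrable \<Omega> (\<lambda>x. S t u0' x - S t u x) \<and> L2_norm \<Omega> (\<lambda>x. S t u0' x - S t u x) < \<epsilon>)"
    by blast
qed

section \<open>Lipschitz bounds for a layer\<close>

definition spectral_op :: "(real^'n) set \<Rightarrow> (real^'n \<Rightarrow> complex^'v^'v) \<Rightarrow> (real^'n \<Rightarrow> real^'v) \<Rightarrow> real^'n \<Rightarrow> real^'v" where
  "spectral_op \<Omega> R v x = (\<chi> i. Re (inverse_fourier_vec (\<lambda>\<xi>. R \<xi> *v fourier_vec \<Omega> v \<xi>) x $ i))"

lemma layer_op_eq: "layer_op \<sigma> \<Omega> l t v x = (\<chi> i. \<sigma> ((W_t l t *v v x + spectral_op \<Omega> (R_t l t) v x) $ i))"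
  by (simp add: layer_op_def spectral_op_def)

lemma borel_measurable_spectral_op:
  fixes v :: "real^'n \<Rightarrow> real^'v"
  assumes "square_integrable UNIV (\<lambda>\<xi>. R \<xi> *v fourier_vec \<Omega> v \<xi>)"
  shows "spectral_op \<Omega> R v \<in> borel_measurable borel"
  using borel_measurable_inverse_fourier_vec[OF assms]
  by (intro borel_measurable_vec) (simp add: spectral_op_def)

text \<open>Taking real parts componentwise does not increase norms, the inverse transform costs the
  factor 2, and linearity of the forward transform reduces the rest to the multiplier acting on u -
  v.\<close>

lemma energy_spectral_op_diff_le:
  fixes u v :: "real^'n \<Rightarrow> real^'v" and R :: "real^'n \<Rightarrow> complex^'v^'v"
  assumes \<Omega>: "open \<Omega>" "bounded \<Omega>" and u: "square_integrable \<Omega> u" and v: "square_integrable \<Omega> v"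
    and R: "\<And>w. square_integrable \<Omega> w \<Longrightarrow> square_integrable UNIV (\<lambda>\<xi>. R \<xi> *v fourier_vec \<Omega> w \<xi>)"
    and K: "0 \<le> K" "bounded_multiplier \<Omega> R K"
  shows "energy (\<lambda>x. spectral_op \<Omega> R u x - spectral_op \<Omega> R v x) \<le> ennreal (2 * K) * energy (zero_ext \<Omega> (\<lambda>x. u x - v x))"
proof -
  let ?h = "\<lambda>w \<xi>. R \<xi> *v fourier_vec \<Omega> w \<xi>"
  have "energy (\<lambda>x. spectral_op \<Omega> R u x - spectral_op \<Omega> R v x) \<le>
      energy (\<lambda>x. inverse_fourier_vec (?h u) x - inverse_fourier_vec (?h v) x)"
  proof (intro energy_mono_AE AE_I2)
    fix x
    have "norm (\<chi> i. Re (z $ i)) \<le> norm z" for z :: "complex^'v"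
      unfolding norm_vec_def by (intro L2_set_mono) (auto simp: abs_Re_le_cmod)
    moreover have "spectral_op \<Omega> R u x - spectral_op \<Omega> R v x =
        (\<chi> i. Re ((inverse_fourier_vec (?h u) x - inverse_fourier_vec (?h v) x) $ i))"
      by (simp add: vec_eq_iff spectral_op_def)
    ultimately show "norm (spectral_op \<Omega> R u x - spectral_op \<Omega> R v x) \<le>
        norm (inverse_fourier_vec (?h u) x - inverse_fourier_vec (?h v) x)"
      by metis
  qed
  also have "\<dots> \<le> 2 * energy (\<lambda>\<xi>. ?h u \<xi> - ?h v \<xi>)"
    by (intro energy_inverse_fourier_vec_diff_le R u v)
  also have "(\<lambda>\<xi>. ?h u \<xi> - ?h v \<xi>) = ?h (\<lambda>x. u x - v x)"
    using fourier_vec_add_scaleR[OF \<Omega> u v, of "- 1"] by (simp add: matrix_vector_mult_diff_distrib)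
  also have "2 * energy \<dots> \<le> 2 * (ennreal K * energy (zero_ext \<Omega> (\<lambda>x. u x - v x)))"
    using K(2) square_integrable_diff[OF u v] unfolding bounded_multiplier_def by (intro mult_left_mono) auto
  finally show ?thesis using K(1) by (simp add: ennreal_mult mult.assoc)
qed

lemma bounded_multiplier_mono:
  "bounded_multiplier \<Omega> R K \<Longrightarrow> K \<le> K' \<Longrightarrow> bounded_multiplier \<Omega> R K'"
  unfolding bounded_multiplier_def
  by (meson ennreal_leI mult_right_mono order_trans zero_le)

text \<open>The activation contributes C^2, and splitting weight from spectral part gives 2 M^2 + 2
  * (2 K). Membership in L2 is deduced from the difference bound by comparing with the image of 0,
  the constant sigma 0, which is square-integrable since Omega is bounded.\<close>

lemma layer_op_bound:
  fixes u v :: "real^'n \<Rightarrow> real^'v"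
  assumes \<Omega>: "open \<Omega>" "bounded \<Omega>" and l: "fno_layer_on \<Omega> l" and t: "0 \<le> t"
    and \<sigma>: "C-lipschitz_on UNIV \<sigma>" and W: "matrix_2norm (W_t l t) \<le> M"
    and K: "0 \<le> K" "bounded_multiplier \<Omega> (R_t l t) K"
    and u: "square_integrable \<Omega> u" and v: "square_integrable \<Omega> v"
  shows "square_integrable \<Omega> (layer_op \<sigma> \<Omega> l t u)"
    and "energy (zero_ext \<Omega> (\<lambda>x. layer_op \<sigma> \<Omega> l t u x - layer_op \<sigma> \<Omega> l t v x)) \<le>
      ennreal (C\<^sup>2 * (2 * M\<^sup>2 + 4 * K)) * energy (zero_ext \<Omega> (\<lambda>x. u x - v x))"
proof -
  have R: "square_integrable UNIV (\<lambda>\<xi>. R_t l t \<xi> *v fourier_vec \<Omega> w \<xi>)" if "square_integrable \<Omega> w" for w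
    using l t that by (simp add: fno_layer_on_def)
  have \<sigma>_meas: "\<sigma> \<in> borel_measurable borel"
    by (intro borel_measurable_continuous_onI lipschitz_on_continuous_on[OF \<sigma>])
  define A where "A w x = W_t l t *v w x + spectral_op \<Omega> (R_t l t) w x" for w x
  have bound: "energy (zero_ext \<Omega> (\<lambda>x. layer_op \<sigma> \<Omega> l t w x - layer_op \<sigma> \<Omega> l t v x)) \<le>
      ennreal (C\<^sup>2 * (2 * M\<^sup>2 + 4 * K)) * energy (zero_ext \<Omega> (\<lambda>x. w x - v x))"
    if w: "square_integrable \<Omega> w" and v: "square_integrable \<Omega> v" for w v
  proof -
    \<comment> \<open>Only the weight part is cut off outside Omega: the spectral part is measurable
      and estimated on the whole space. On Omega the two add up to the difference of the arguments
      of sigma, and elsewhere the left side vanishes.\<close>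
    let ?W = "zero_ext \<Omega> (\<lambda>x. W_t l t *v (w x - v x))"
    let ?S = "\<lambda>x. spectral_op \<Omega> (R_t l t) w x - spectral_op \<Omega> (R_t l t) v x"
    have Wm: "?W \<in> borel_measurable borel"
      using square_integrable_matrix_vector_mult[OF square_integrable_diff[OF w v], of "W_t l t"]
      by (simp add: square_integrable_iff)
    have Sm: "?S \<in> borel_measurable borel"
      by (intro borel_measurable_diff borel_measurable_spectral_op R w v)
    have "energy (zero_ext \<Omega> (\<lambda>x. layer_op \<sigma> \<Omega> l t w x - layer_op \<sigma> \<Omega> l t v x)) \<le>
        ennreal (C\<^sup>2) * energy (\<lambda>x. ?W x + ?S x)"
    proof (intro energy_le_of_norm_le AE_I2)
      show "(\<lambda>x. ?W x + ?S x) \<in> borel_measurable borel"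
        by (rule borel_measurable_add[OF Wm Sm])
      fix x
      have "norm (layer_op \<sigma> \<Omega> l t w x - layer_op \<sigma> \<Omega> l t v x) \<le> norm (C *\<^sub>R (A w x - A v x))"
      proof (rule norm_le_componentwise_cart)
        fix i
        have "dist (\<sigma> (A w x $ i)) (\<sigma> (A v x $ i)) \<le> C * dist (A w x $ i) (A v x $ i)"
          by (rule lipschitz_onD[OF \<sigma>]) auto
        then show "norm ((layer_op \<sigma> \<Omega> l t w x - layer_op \<sigma> \<Omega> l t v x) $ i) \<le> norm ((C *\<^sub>R (A w x - A v x)) $ i)"
          using lipschitz_on_nonneg[OF \<sigma>] by (simp add: layer_op_eq A_def dist_real_def abs_mult)
      qed
      also have "\<dots> = C * norm (A w x - A v x)"
        using lipschitz_on_nonneg[OF \<sigma>] by simp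
      finally have *: "norm (layer_op \<sigma> \<Omega> l t w x - layer_op \<sigma> \<Omega> l t v x) \<le> C * norm (A w x - A v x)" .
      have "A w x - A v x = ?W x + ?S x" if "x \<in> \<Omega>"
        using that by (simp add: A_def zero_ext_def matrix_vector_mult_diff_distrib)
      with * show "norm (zero_ext \<Omega> (\<lambda>x. layer_op \<sigma> \<Omega> l t w x - layer_op \<sigma> \<Omega> l t v x) x) \<le> C * norm (?W x + ?S x)"
        using lipschitz_on_nonneg[OF \<sigma>] by (cases "x \<in> \<Omega>") (auto simp: zero_ext_def)
    qed
    also have "\<dots> \<le> ennreal (C\<^sup>2) * (2 * energy ?W + 2 * energy ?S)"
      by (intro mult_left_mono energy_add_le Wm Sm) simp
    also have "\<dots> \<le> ennreal (C\<^sup>2) * (2 * (ennreal (M\<^sup>2) * energy (zero_ext \<Omega> (\<lambda>x. w x - v x))) +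
        2 * (ennreal (2 * K) * energy (zero_ext \<Omega> (\<lambda>x. w x - v x))))"
      by (intro mult_left_mono add_mono energy_matrix_vector_mult_le W
          energy_spectral_op_diff_le \<Omega> R K square_integrable_diff w v) auto
    also have "\<dots> = ennreal (C\<^sup>2 * (2 * M\<^sup>2 + 4 * K)) * energy (zero_ext \<Omega> (\<lambda>x. w x - v x))"
      using K(1) by (simp add: ennreal_mult ennreal_plus distrib_right distrib_left mult.assoc)
    finally show ?thesis .
  qed
  show "energy (zero_ext \<Omega> (\<lambda>x. layer_op \<sigma> \<Omega> l t u x - layer_op \<sigma> \<Omega> l t v x)) \<le>
      ennreal (C\<^sup>2 * (2 * M\<^sup>2 + 4 * K)) * energy (zero_ext \<Omega> (\<lambda>x. u x - v x))"
    by (rule bound[OF u v])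
  have meas: "zero_ext \<Omega> (layer_op \<sigma> \<Omega> l t w) \<in> borel_measurable borel" if w: "square_integrable \<Omega> w" for w
  proof -
    \<comment> \<open>w itself may be nonmeasurable off Omega, so its zero extension is inserted.
      The layer is unchanged on Omega.\<close>
    define B where "B x = W_t l t *v zero_ext \<Omega> w x + spectral_op \<Omega> (R_t l t) w x" for x
    have "B \<in> borel_measurable borel"
      unfolding B_def[abs_def] using w
      by (intro borel_measurable_add borel_measurable_matrix_vector_mult borel_measurable_spectral_op R)
        (auto simp: square_integrable_iff)
    then have "(\<lambda>x. \<chi> i. \<sigma> (B x $ i)) \<in> borel_measurable borel"
      by (intro borel_measurable_vec) (auto intro: measurable_compose[OF _ \<sigma>_meas])
    then have "zero_ext \<Omega> (\<lambda>x. \<chi> i. \<sigma> (B x $ i)) \<in> borel_measurable borel"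
      unfolding zero_ext_def using \<Omega>(1) by (intro borel_measurable_scaleR borel_measurable_indicator) auto
    also have "zero_ext \<Omega> (\<lambda>x. \<chi> i. \<sigma> (B x $ i)) = zero_ext \<Omega> (layer_op \<sigma> \<Omega> l t w)"
      by (auto simp: fun_eq_iff zero_ext_def B_def layer_op_eq indicator_def)
    finally show ?thesis .
  qed
  let ?z = "\<lambda>x::real^'n. 0::real^'v"
  have z: "square_integrable \<Omega> ?z" by (rule square_integrable_zero)
  have const: "layer_op \<sigma> \<Omega> l t ?z x = (\<chi> i. \<sigma> 0)" for x
    by (simp add: layer_op_def fourier_vec_zero inverse_fourier_vec_zero)
  have "energy (zero_ext \<Omega> (layer_op \<sigma> \<Omega> l t ?z)) =
      (\<integral>\<^sup>+ x. ennreal ((norm ((\<chi> i. \<sigma> 0) :: real^'v))\<^sup>2) * indicator \<Omega> x \<partial>lborel)"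
    unfolding energy_def norm_zero_ext_square const
    by (intro nn_integral_cong) (auto simp: indicator_def)
  also have "\<dots> = ennreal ((norm ((\<chi> i. \<sigma> 0) :: real^'v))\<^sup>2) * emeasure lborel \<Omega>"
    using \<Omega>(1) by (intro nn_integral_cmult_indicator) auto
  also have "\<dots> < \<infinity>"
    using emeasure_bounded_finite[OF \<Omega>(2)] by (simp add: ennreal_mult_less_top)
  finally have z_int: "square_integrable \<Omega> (layer_op \<sigma> \<Omega> l t ?z)"
    using meas[OF z] by (simp add: square_integrable_iff)
  have "energy (zero_ext \<Omega> (\<lambda>x. layer_op \<sigma> \<Omega> l t u x - layer_op \<sigma> \<Omega> l t ?z x)) < \<infinity>"
    using bound[OF u z] u
    by (intro le_less_trans[OF bound[OF u z]]) (simp add: square_integrable_iff ennreal_mult_less_top)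
  moreover have "zero_ext \<Omega> (\<lambda>x. layer_op \<sigma> \<Omega> l t u x - layer_op \<sigma> \<Omega> l t ?z x) \<in> borel_measurable borel"
    unfolding zero_ext_diff by (intro borel_measurable_diff meas u z)
  ultimately have "square_integrable \<Omega> (\<lambda>x. layer_op \<sigma> \<Omega> l t u x - layer_op \<sigma> \<Omega> l t ?z x)"
    by (simp add: square_integrable_iff)
  from square_integrable_add[OF this z_int]
  show "square_integrable \<Omega> (layer_op \<sigma> \<Omega> l t u)" by simp
qed

text \<open>The hypotheses leave out only t = 0. A single time adds one constant for the multiplier
  and one for the weight matrix, and maxima absorb both.\<close>

lemma L2_lipschitz_layer_op:
  fixes l :: "('n::finite, 'v::finite) fno_layer"
  assumes \<Omega>: "open \<Omega>" "bounded \<Omega>" and l: "fno_layer_on \<Omega> l" and \<sigma>: "C-lipschitz_on UNIV \<sigma>"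
    and R: "\<And>t. 0 < t \<Longrightarrow> AE \<xi> in lborel. matrix_2norm (R_t l t \<xi>) \<le> M"
    and W: "\<And>t. 0 < t \<Longrightarrow> matrix_2norm (W_t l t) \<le> N"
  shows "L2_lipschitz \<Omega> (layer_op \<sigma> \<Omega> l)"
proof -
  obtain K0 where K0: "bounded_multiplier \<Omega> (R_t l 0) K0"
    using bounded_multiplier_of_square_integrable[OF \<Omega>, of "R_t l 0"] borel_measurable_R_t[OF l order_refl] l
    unfolding fno_layer_on_def by blast
  \<comment> \<open>The maximum with a square also makes K nonnegative.\<close>
  define K where "K = max K0 (M\<^sup>2)"
  define N' where "N' = max N (matrix_2norm (W_t l 0))"
  have K: "0 \<le> K" by (simp add: K_def le_max_iff_disj)
  have mult: "bounded_multiplier \<Omega> (R_t l t) K" if "0 \<le> t" for t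
  proof (cases "t = 0")
    case True
    then show ?thesis using K0 by (auto simp: K_def intro: bounded_multiplier_mono)
  next
    case False
    then have "0 < t" using that by simp
    from bounded_multiplier_of_AE[OF \<Omega> R[OF this]] show ?thesis
      by (auto simp: K_def intro: bounded_multiplier_mono)
  qed
  have weight: "matrix_2norm (W_t l t) \<le> N'" if "0 \<le> t" for t
    using W[of t] that by (cases "t = 0") (auto simp: N'_def le_max_iff_disj)
  have C: "0 \<le> C\<^sup>2 * (2 * N'\<^sup>2 + 4 * K)" using K by simp
  show ?thesis
    unfolding L2_lipschitz_def
    by (intro exI[of _ "C\<^sup>2 * (2 * N'\<^sup>2 + 4 * K)"] conjI allI impI C)
       (rule layer_op_bound[OF \<Omega> l _ \<sigma> weight K mult]; assumption)+
qed

text \<open>The bounds are chosen before t, as stability fixes delta before t. The bound on R holds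
  almost everywhere because the transform of a kernel in L2 is determined only up to a null
  set.\<close>

theorem proposition3p4:
  fixes \<Omega> :: "(real^'n::finite) set"
    and \<sigma> :: "real \<Rightarrow> real"
    and P :: "real^'a::finite^'v::finite"
    and ls :: "('n, 'v) fno_layer list"
    and Q :: "real^'v^'u::finite"
  assumes domain: "open \<Omega>" "connected \<Omega>" "\<Omega> \<noteq> {}" "bounded \<Omega>"
    and layers: "\<And>l. l \<in> set ls \<Longrightarrow> fno_layer_on \<Omega> l"
    and lipschitz: "\<exists>C. C-lipschitz_on UNIV \<sigma>"
    and R_bounded: "\<And>l. l \<in> set ls \<Longrightarrow>
          \<exists>M. \<forall>t>0. AE \<xi> in lborel. matrix_2norm (R_t l t \<xi>) \<le> M"
    and W_bounded: "\<And>l. l \<in> set ls \<Longrightarrow> \<exists>M. \<forall>t>0. matrix_2norm (W_t l t) \<le> M"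
  shows "L2_stable \<Omega> (ctfno \<sigma> \<Omega> P ls Q)"
proof -
  obtain C where C: "C-lipschitz_on UNIV \<sigma>" using lipschitz by blast
  have "L2_lipschitz \<Omega> (layer_op \<sigma> \<Omega> l)" if l: "l \<in> set ls" for l
  proof -
    obtain M N where "\<forall>t>0. AE \<xi> in lborel. matrix_2norm (R_t l t \<xi>) \<le> M" "\<forall>t>0. matrix_2norm (W_t l t) \<le> N"
      using R_bounded[OF l] W_bounded[OF l] by blast
    then show ?thesis
      by (intro L2_lipschitz_layer_op[OF domain(1,4) layers[OF l] C, of M N]) simp_all
  qed
  then have "L2_lipschitz \<Omega> (\<lambda>t u. fold (\<lambda>l. layer_op \<sigma> \<Omega> l t) ls u)"
    by (rule L2_lipschitz_fold)
  from L2_lipschitz_compose[OF L2_lipschitz_compose[OF L2_lipschitz_matrix[of \<Omega> P] this] L2_lipschitz_matrix[of \<Omega> Q]]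
  have "L2_lipschitz \<Omega> (ctfno \<sigma> \<Omega> P ls Q)"
    by (simp add: ctfno_def[abs_def])
  then show ?thesis by (rule L2_stable_of_L2_lipschitz)
qed

end
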